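(* Let $d\ge 2$ and let $\mathcal F=\{\mathcal T_h\}_{h\to 0}$ be a family of face-to-face partitions of a polytope $\overline\Omega\subset\mathbb R^d$ into $d$-simplices. Then $\mathcal F$ satisfies the $d$-dimensional maximum angle condition if and only if $\mathcal F$ satisfies the generalized maximum angle condition.
   Context: A $d$-simplex in $\mathbb R^d$ is $S=\operatorname{conv}\{A_0,\dots,A_d\}$ where the vertices $A_0,\dots,A_d$ do not lie in a common hyperplane. A family $\mathcal F=\{\mathcal T_h\}_{h\to0}$ of face-to-face (conforming) partitions is a family of partitions $\mathcal T_h$ of $\overline\Omega$ into $d$-simplices such that any two simplices of $\mathcal T_h$ intersect in a common face (or not at all); $h$ is the mesh size. Dihedral angles: for a simplex of dimension $k\ge2$ (regarded inside its $k$-dimensional affine hull), the dihedral angle $\beta_{ij}\in(0,\pi)$ between two distinct facets $F_i,F_j$ is defined by $\cos\beta_{ij}=-n_i\cdot n_j$, where $n_i,n_j$ are the outward unit normals of $F_i,F_j$ (in the affine hull). $d$-sine: for a $d$-simplex $S=\operatorname{conv}\{A_0,\dots,A_d\}$ with facets $F_j$ opposite to $A_j$, the $d$-sine of the angle $\hat A_i$ at the vertex $A_i$ is $$\sin_d(\hat A_i\mid A_0A_1\dots A_d)=\frac{d^{\,d-1}(\operatorname{meas}_d S)^{d-1}}{(d-1)!\,\prod_{j=0,\,j\ne i}^{d}\operatorname{meas}_{d-1}F_j}.$$ For $d$ linearly independent vectors $\vec v_1,\dots,\vec v_d\in\mathbb R^d$, $\sin_d(\vec v_1,\dots,\vec v_d)$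 is the $d$-sine of the angle at the origin of the simplex whose vertices are the origin and the endpoints of the $\vec v_i$ (this value is unchanged when a $\vec v_i$ is multiplied by a nonzero constant, so only the directions matter). For linearly dependent vectors $\sin_d:=0$. Generalized maximum angle condition: there exists a constant $C>0$ such that for every $\mathcal T_h\in\mathcal F$ and every $S\in\mathcal T_h$ one can choose $d$ edges of $S$ which, considered as vectors (translated to start at the origin), satisfy $\sin_d\ge C$. $d$-dimensional maximum angle condition: there exists a constant $\gamma_0<\pi$ such that for every $\mathcal T_h\in\mathcal F$, every $S\in\mathcal T_h$ and every subsimplex $S'\subseteq S$ (of dimension at least $2$, including $S'=S$) whose vertex set is contained in the vertex set of $S$, the maximum dihedral angle of $S'$ is at most $\gamma_0$. *)

theory Defs
  imports "HOL-Analysis.Analysis"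
begin

text \<open>The space \<open>\<real>\<^sup>d\<close> is \<open>real ^ 'n\<close> with \<open>d = CARD('n)\<close>. Simplices, faces, facets, edges, vertices
  (extreme points) and face-to-face partitions (\<open>triangulation\<close>) are those of
  \<open>HOL-Analysis.Polytope\<close>.\<close>

section \<open>Lebesgue measure on the affine hull of a set\<close>

definition directions :: "'a::euclidean_space set \<Rightarrow> 'a set" where
  "directions X = span {x - y | x y. x \<in> X \<and> y \<in> X}"

definition orthonormal_basis_of :: "'a::euclidean_space set \<Rightarrow> 'a set \<Rightarrow> bool" where
  "orthonormal_basis_of B W \<longleftrightarrow>
     pairwise orthogonal B \<and> (\<forall>b\<in>B. norm b = 1) \<and> span B = W"

text \<open>For a Borel set \<open>X\<close> with \<open>aff_dim X = k\<close> this is the \<open>k\<close>-dimensional measure of \<open>X\<close>: the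
  \<open>k\<close>-dimensional Lebesgue measure is transported to the affine hull of \<open>X\<close> by orthonormal
  coordinates. The value does not depend on the basis or on the origin chosen. The construction
  is the one by which \<open>lborel\<close> is defined, with \<open>Basis\<close> replaced by an orthonormal basis of the
  directions of \<open>X\<close>.\<close>

definition flat_lborel :: "'a::euclidean_space \<Rightarrow> 'a set \<Rightarrow> 'a measure" where
  "flat_lborel p B =
     distr (\<Pi>\<^sub>M b\<in>B. (lborel :: real measure)) borel (\<lambda>f. p + (\<Sum>b\<in>B. f b *\<^sub>R b))"

definition flat_measure :: "'a::euclidean_space set \<Rightarrow> real" where
  "flat_measure X =
     measure (flat_lborel (SOME p. p \<in> X) (SOME B. orthonormal_basis_of B (directions X))) X"

section \<open>Dihedral angles\<close>

definition is_outward_normal :: "'a::euclidean_space set \<Rightarrow> 'a set \<Rightarrow> 'a \<Rightarrow> bool" where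
  "is_outward_normal S F n \<longleftrightarrow>
     n \<in> directions S \<and> norm n = 1 \<and>
     (\<forall>x\<in>F. \<forall>y\<in>F. n \<bullet> (x - y) = 0) \<and> (\<forall>x\<in>S. \<forall>y\<in>F. n \<bullet> (x - y) \<le> 0)"

definition outward_normal :: "'a::euclidean_space set \<Rightarrow> 'a set \<Rightarrow> 'a" where
  "outward_normal S F = (THE n. is_outward_normal S F n)"

definition dihedral_angle :: "'a::euclidean_space set \<Rightarrow> 'a set \<Rightarrow> 'a set \<Rightarrow> real" where
  "dihedral_angle S F G = arccos (- (outward_normal S F \<bullet> outward_normal S G))"

definition max_dihedral_angle :: "'a::euclidean_space set \<Rightarrow> real" where
  "max_dihedral_angle S =
     Max {dihedral_angle S F G | F G. F facet_of S \<and> G facet_of S \<and> F \<noteq> G}"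

section \<open>The \<open>d\<close>-sine\<close>

text \<open>\<open>V\<close> is the vertex set of the simplex and \<open>A \<in> V\<close>; the facet opposite to the vertex \<open>B\<close> is
  \<open>convex hull (V - {B})\<close>.\<close>

definition d_sine :: "real ^ 'n \<Rightarrow> (real ^ 'n) set \<Rightarrow> real" where
  "d_sine A V =
     real CARD('n) ^ (CARD('n) - 1) * measure lebesgue (convex hull V) ^ (CARD('n) - 1) /
     (fact (CARD('n) - 1) * (\<Prod>B\<in>V - {A}. flat_measure (convex hull (V - {B}))))"

definition d_sine_vectors :: "('n \<Rightarrow> real ^ 'n) \<Rightarrow> real" where
  "d_sine_vectors v =
     (if inj v \<and> independent (range v) then d_sine 0 (insert 0 (range v)) else 0)"

section \<open>Families of partitions and the angle conditions\<close>

text \<open>Neither convexity nor connectedness of \<open>\<Omega>\<close> is required, so the library's (convex)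
  \<open>polytope\<close> is too narrow.\<close>

definition polytopic :: "'a::euclidean_space set \<Rightarrow> bool" where
  "polytopic \<Omega> \<longleftrightarrow> open \<Omega> \<and> \<Omega> \<noteq> {} \<and> bounded \<Omega> \<and>
     (\<exists>H. finite H \<and> (\<forall>h\<in>H. \<exists>a b. a \<noteq> 0 \<and> h = {x. a \<bullet> x = b}) \<and>
          frontier (closure \<Omega>) \<subseteq> \<Union>H)"

definition face_to_face_partition :: "(real ^ 'n) set \<Rightarrow> (real ^ 'n) set set \<Rightarrow> bool" where
  "face_to_face_partition P \<T> \<longleftrightarrow>
     triangulation \<T> \<and> (\<forall>S\<in>\<T>. int CARD('n) simplex S) \<and> \<Union>\<T> = P"

definition mesh_size :: "'a::metric_space set set \<Rightarrow> real" where
  "mesh_size \<T> = Max (diameter ` \<T>)"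

text \<open>The index \<open>h\<close> of a partition in \<open>{\<T>\<^sub>h}\<close> is its mesh size, and \<open>h \<rightarrow> 0\<close> means that
  the family contains partitions of arbitrarily small mesh size.\<close>

definition partition_family :: "(real ^ 'n) set \<Rightarrow> (real ^ 'n) set set set \<Rightarrow> bool" where
  "partition_family P \<F> \<longleftrightarrow>
     (\<forall>\<T>\<in>\<F>. face_to_face_partition P \<T>) \<and> (\<forall>\<epsilon>>0. \<exists>\<T>\<in>\<F>. mesh_size \<T> < \<epsilon>)"

definition subsimplex :: "int \<Rightarrow> 'a::euclidean_space set \<Rightarrow> 'a set \<Rightarrow> bool" where
  "subsimplex k S' S \<longleftrightarrow>
     k simplex S' \<and> S' \<subseteq> S \<and> {x. x extreme_point_of S'} \<subseteq> {x. x extreme_point_of S}"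

definition maximum_angle_condition :: "(real ^ 'n) set set set \<Rightarrow> bool" where
  "maximum_angle_condition \<F> \<longleftrightarrow>
     (\<exists>\<gamma>\<^sub>0<pi. \<forall>\<T>\<in>\<F>. \<forall>S\<in>\<T>. \<forall>k S'. k \<ge> 2 \<and> subsimplex k S' S \<longrightarrow> max_dihedral_angle S' \<le> \<gamma>\<^sub>0)"

text \<open>The \<open>d\<close> chosen edges are the segments from \<open>a i\<close> to \<open>b i\<close>, each with an arbitrary
  orientation.\<close>

definition generalized_maximum_angle_condition :: "(real ^ 'n) set set set \<Rightarrow> bool" where
  "generalized_maximum_angle_condition \<F> \<longleftrightarrow>
     (\<exists>C>0. \<forall>\<T>\<in>\<F>. \<forall>S\<in>\<T>. \<exists>a b :: 'n \<Rightarrow> real ^ 'n.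
        inj (\<lambda>i. closed_segment (a i) (b i)) \<and>
        (\<forall>i. closed_segment (a i) (b i) edge_of S) \<and>
        d_sine_vectors (\<lambda>i. b i - a i) \<ge> C)"

end

theory Submission
  imports Defs
begin

text \<open>Call the vertex set \<open>V\<close> of a simplex \<open>\<kappa>\<close>-aligned if every direction \<open>x\<close> of its affine hull makes an
  angle with cosine at least \<open>\<kappa>\<close> in absolute value with some edge. Both conditions of the theorem
  are equivalent to alignment with a constant uniform over the family.

  For the maximum angle condition: if \<open>n\<close> and \<open>m\<close> are the outward normals of two facets, then
  \<open>\<bar>n \<bullet> u\<bar> \<le> \<bar>(n - m) \<bullet> u\<bar>\<close> for every edge \<open>u\<close>, so alignment keeps \<open>n\<close> and \<open>m\<close> apart, i.e. the dihedral
  angle away from \<open>\<pi>\<close>; and alignment is inherited by faces. Conversely, if all facets are aligned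
  but \<open>V\<close> is not, then a unit vector almost orthogonal to all edges is almost normal to every
  facet, and among three facets two outward normals must nearly coincide.

  For the generalized condition: with \<open>w\<close> the basis dual to \<open>v\<close>, the \<open>d\<close>-sine of \<open>v\<close> is
  \<open>1 / (\<bar>det v\<bar> \<Prod> \<parallel>w\<^sub>i\<parallel>)\<close>, which is bounded below exactly when the products
  \<open>\<parallel>v\<^sub>i\<parallel> \<parallel>w\<^sub>i\<parallel>\<close> are bounded above. Given alignment, \<open>d\<close> edges maximizing the normalized
  determinant achieve this by Cramer's rule.\<close>

section \<open>Linear images and Lebesgue measure\<close>

text \<open>The library has this only for a well-ordered index type (\<open>measure_linear_image\<close>).\<close>

lemma measure_linear_image_cart:
  fixes f :: "real ^ 'n \<Rightarrow> real ^ 'n"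
  assumes "linear f" "S \<in> lmeasurable"
  shows "f ` S \<in> lmeasurable \<and> measure lebesgue (f ` S) = \<bar>det (matrix f)\<bar> * measure lebesgue S"
proof -
  \<comment> \<open>It suffices to know the scaling factor on boxes; the transposition and the shear
    below are reduced to boxes in this way.\<close>
  have sufficient: "f ` S \<in> lmeasurable \<and> measure lebesgue (f ` S) = \<bar>det (matrix f)\<bar> * measure lebesgue S"
    if "linear f" "\<And>a b. measure lebesgue (f ` cbox a b) = \<bar>det (matrix f)\<bar> * measure lebesgue (cbox a b)"
      "S \<in> lmeasurable" for f :: "real ^ 'n \<Rightarrow> real ^ 'n" and S :: "(real ^ 'n) set"
    using measure_linear_sufficient[OF that(1,3,2)] by simp
  \<comment> \<open>Every linear map is composed of maps with a vanishing coordinate, stretches,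
    transpositions and shears, and the scaling factor is multiplicative under composition.\<close>
  have "\<forall>S\<in>lmeasurable. f ` S \<in> lmeasurable \<and>
          measure lebesgue (f ` S) = \<bar>det (matrix f)\<bar> * measure lebesgue S"
    using \<open>linear f\<close>
  proof (rule induct_linear_elementary; intro ballI)
    fix f g :: "real ^ 'n \<Rightarrow> real ^ 'n" and S :: "(real ^ 'n) set"
    assume lin: "linear f" "linear g"
      and f: "\<forall>S\<in>lmeasurable. f ` S \<in> lmeasurable \<and>
          measure lebesgue (f ` S) = \<bar>det (matrix f)\<bar> * measure lebesgue S"
      and g: "\<forall>S\<in>lmeasurable. g ` S \<in> lmeasurable \<and>
          measure lebesgue (g ` S) = \<bar>det (matrix g)\<bar> * measure lebesgue S"
      and "S \<in> lmeasurable"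
    then show "(f \<circ> g) ` S \<in> lmeasurable \<and>
        measure lebesgue ((f \<circ> g) ` S) = \<bar>det (matrix (f \<circ> g))\<bar> * measure lebesgue S"
      unfolding image_comp [symmetric] matrix_compose[OF lin(2,1)] det_mul abs_mult by simp
  next
    fix f :: "real ^ 'n \<Rightarrow> real ^ 'n" and i and S :: "(real ^ 'n) set"
    assume f: "linear f" "\<And>x. f x $ i = 0"
    \<comment> \<open>With a vanishing coordinate both sides are zero: the image is negligible and
      the determinant is 0.\<close>
    then have "\<not> surj f"
      by (metis one_neq_zero surjE vec_component)
    then have "\<not> inj f"
      using f(1) linear_injective_imp_surjective by blast
    then show "f ` S \<in> lmeasurable \<and> measure lebesgue (f ` S) = \<bar>det (matrix f)\<bar> * measure lebesgue S"
      using f(1) negligible_linear_singular_image[OF f(1), of S] det_nz_iff_inj[OF f(1)]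
      by (simp add: negligible_iff_measure)
  next
    fix c :: "'n \<Rightarrow> real" and S :: "(real ^ 'n) set"
    assume "S \<in> lmeasurable"
    then show "(\<lambda>x. \<chi> i. c i * x $ i) ` S \<in> lmeasurable \<and> measure lebesgue ((\<lambda>x. \<chi> i. c i * x $ i) ` S)
        = \<bar>det (matrix (\<lambda>x. \<chi> i. c i * x $ i))\<bar> * measure lebesgue S"
      by (simp add: measurable_stretch measure_stretch matrix_def axis_def det_diagonal)
  next
    fix m n :: 'n and S :: "(real ^ 'n) set"
    let ?h = "\<lambda>x. \<chi> i. x $ Transposition.transpose m n i :: real ^ 'n"
    assume S: "S \<in> lmeasurable"
    have lin: "linear ?h"
      by (rule linearI) (simp_all add: vec_eq_iff)
    \<comment> \<open>An involution has determinant 1 or -1; the sign is irrelevant for the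
      measure.\<close>
    have invol: "?h \<circ> ?h = id"
      by (simp add: fun_eq_iff vec_eq_iff)
    then have "det (matrix ?h) * det (matrix ?h) = 1"
      using matrix_compose[OF lin lin] by (metis det_mul matrix_id)
    then have det: "\<bar>det (matrix ?h)\<bar> = 1"
      by (simp add: abs_square_eq_1 flip: power2_eq_square)
    have "measure lebesgue (?h ` cbox a b) = measure lebesgue (cbox a b)" for a b
    proof -
      have "?h ` cbox a b = cbox (?h a) (?h b)"
      proof (intro equalityI subsetI)
        fix x assume "x \<in> cbox (?h a) (?h b)"
        then have "?h x \<in> cbox a b"
          by (simp add: mem_box_cart) (metis transpose_involutory)
        then show "x \<in> ?h ` cbox a b"
          using fun_cong[OF invol, of x] by (metis (no_types, lifting) comp_apply id_apply image_eqI)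
      qed (auto simp: mem_box_cart)
      moreover have "(\<Prod>i\<in>UNIV. (b - a) $ Transposition.transpose m n i) = (\<Prod>i\<in>UNIV. (b - a) $ i)"
        by (rule prod.reindex_bij_betw) (simp add: bij_betw_def)
      moreover have "cbox a b = {} \<longleftrightarrow> cbox (?h a) (?h b) = {}"
        using \<open>?h ` cbox a b = cbox (?h a) (?h b)\<close> by blast
      ultimately show ?thesis
        by (simp add: content_cbox_if_cart)
    qed
    then show "?h ` S \<in> lmeasurable \<and> measure lebesgue (?h ` S) = \<bar>det (matrix ?h)\<bar> * measure lebesgue S"
      using sufficient[OF lin _ S] det by simp
  next
    fix m n :: 'n and S :: "(real ^ 'n) set"
    let ?h = "\<lambda>x. \<chi> i. if i = m then x $ m + x $ n else x $ i :: real ^ 'n"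
    assume "m \<noteq> n" and S: "S \<in> lmeasurable"
    have lin: "linear ?h"
      by (rule linearI) (auto simp: vec_eq_iff algebra_simps)
    have "matrix ?h = (\<chi> k. if k = m then row m (mat 1) + 1 *s row n (mat 1) else row k (mat 1))"
      by (auto simp: matrix_def vec_eq_iff row_def mat_def axis_def)
    then have det: "det (matrix ?h) = 1"
      using det_row_operation[OF \<open>m \<noteq> n\<close>, of "mat 1" 1] by simp
    have "measure lebesgue (?h ` cbox a b) = measure lebesgue (cbox a b)" for a b
    proof (cases "cbox a b = {}")
      case False
      \<comment> \<open>\<open>measure_shear_interval\<close> asks for a nonnegative
        \<open>n\<close>-th coordinate of the lower corner; translating by \<open>t\<close> makes it
        0.\<close>
      define t where "t = (a $ n) *\<^sub>R (axis n 1 :: real ^ 'n)"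
      have box: "cbox a b = (+) t ` cbox (a - t) (b - t)"
        by (simp add: cbox_translation[symmetric])
      have "?h ` cbox a b = (+) (?h t) ` ?h ` cbox (a - t) (b - t)"
        unfolding box image_image by (intro image_cong refl) (simp add: vec_eq_iff)
      then have "measure lebesgue (?h ` cbox a b) = measure lebesgue (?h ` cbox (a - t) (b - t))"
        by (simp only: measure_translation)
      also have "\<dots> = measure lebesgue (cbox (a - t) (b - t))"
        using False box by (intro measure_shear_interval \<open>m \<noteq> n\<close>) (auto simp: t_def axis_def)
      also have "\<dots> = measure lebesgue (cbox a b)"
        unfolding box by (simp only: measure_translation)
      finally show ?thesis .
    qed simp
    then show "?h ` S \<in> lmeasurable \<and> measure lebesgue (?h ` S) = \<bar>det (matrix ?h)\<bar> * measure lebesgue S"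
      using sufficient[OF lin _ S] det by simp
  qed
  with assms(2) show ?thesis
    by blast
qed

text \<open>Lebesgue measure is determined by its values on boxes, and the preimage of a box is its
  image under \<open>inv f\<close>, which is again orthogonal and has determinant 1 or -1.\<close>

lemma distr_lborel_orthogonal:
  fixes f :: "real ^ 'n \<Rightarrow> real ^ 'n"
  assumes f: "orthogonal_transformation f"
  shows "distr lborel borel f = lborel"
proof (rule lborel_eqI[symmetric])
  fix l u :: "real ^ 'n"
  assume le: "\<And>b. b \<in> Basis \<Longrightarrow> l \<bullet> b \<le> u \<bullet> b"
  have bij: "bij f" and inv: "orthogonal_transformation (inv f)"
    using f by (simp_all add: orthogonal_transformation_bij orthogonal_transformation_inv)
  have meas [measurable]: "f \<in> borel \<rightarrow>\<^sub>M borel"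
    using f by (intro borel_measurable_continuous_onI linear_continuous_on linear_conv_bounded_linear[THEN iffD1]
        orthogonal_transformation_linear)
  have "emeasure (distr lborel borel f) (box l u) = emeasure lborel (f -` box l u)"
    by (simp add: emeasure_distr)
  also have "\<dots> = emeasure lebesgue (inv f ` box l u)"
    using measurable_sets[OF meas, of "box l u"] bij
    by (simp add: bij_vimage_eq_inv_image)
  also have "\<dots> = ennreal (measure lebesgue (inv f ` box l u))"
    using measure_linear_image_cart[OF orthogonal_transformation_linear[OF inv], of "box l u"]
    by (intro emeasure_eq_measure2) auto
  also have "\<dots> = ennreal (measure lebesgue (box l u))"
    using measure_linear_image_cart[OF orthogonal_transformation_linear[OF inv], of "box l u"]
      orthogonal_transformation_det[OF inv] by simp
  also have "\<dots> = ennreal (\<Prod>b\<in>Basis. (u - l) \<bullet> b)"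
    using le by (simp add: measure_def)
  finally show "emeasure (distr lborel borel f) (box l u) = ennreal (\<Prod>b\<in>Basis. (u - l) \<bullet> b)" .
qed simp

text \<open>The coordinates of \<open>lborel\<close> are indexed by \<open>Basis\<close>, those of
  \<open>flat_lborel\<close> by another orthonormal basis; renaming the indices along a bijection
  makes the two comparable.\<close>

lemma distr_PiM_lborel_reindex:
  assumes g: "bij_betw g A B" and "finite B"
  shows "distr (\<Pi>\<^sub>M a\<in>A. (lborel :: real measure)) (\<Pi>\<^sub>M b\<in>B. lborel) (\<lambda>f. \<lambda>b\<in>B. f (inv_into A g b))
    = (\<Pi>\<^sub>M b\<in>B. lborel)"
proof -
  interpret product_sigma_finite "\<lambda>_. lborel :: real measure" ..
  have "finite A"
    using assms bij_betw_finite by blast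
  have inv_in: "inv_into A g b \<in> A" if "b \<in> B" for b
    using g that by (metis bij_betw_def inv_into_into)
  have ginv: "inv_into A g (g a) = a" if "a \<in> A" for a
    using g that by (simp add: bij_betw_inv_into_left)
  have [measurable]: "(\<lambda>f. \<lambda>b\<in>B. f (inv_into A g b)) \<in>
      (\<Pi>\<^sub>M a\<in>A. (lborel :: real measure)) \<rightarrow>\<^sub>M (\<Pi>\<^sub>M b\<in>B. lborel)"
    by (intro measurable_restrict measurable_component_singleton inv_in)
  show ?thesis
  proof (rule PiM_eqI)
    fix X :: "'b \<Rightarrow> real set"
    assume X: "\<And>b. b \<in> B \<Longrightarrow> X b \<in> sets lborel"
    have "(\<lambda>f. \<lambda>b\<in>B. f (inv_into A g b)) -` (Pi\<^sub>E B X) \<inter> space (\<Pi>\<^sub>M a\<in>A. (lborel :: real measure))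
        = Pi\<^sub>E A (\<lambda>a. X (g a))"
      using g by (auto simp: space_PiM PiE_iff extensional_def bij_betw_def ginv)
    then have "emeasure (distr (\<Pi>\<^sub>M a\<in>A. (lborel :: real measure)) (\<Pi>\<^sub>M b\<in>B. lborel)
          (\<lambda>f. \<lambda>b\<in>B. f (inv_into A g b))) (Pi\<^sub>E B X)
        = emeasure (\<Pi>\<^sub>M a\<in>A. (lborel :: real measure)) (Pi\<^sub>E A (\<lambda>a. X (g a)))"
      using X \<open>finite B\<close> by (subst emeasure_distr) (auto intro!: sets_PiM_I_finite)
    also have "\<dots> = (\<Prod>a\<in>A. emeasure lborel (X (g a)))"
      using X g \<open>finite A\<close> by (intro emeasure_PiM) (auto simp: bij_betw_def)
    also have "\<dots> = (\<Prod>b\<in>B. emeasure lborel (X b))"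
      by (rule prod.reindex_bij_betw[OF g])
    finally show "emeasure (distr (\<Pi>\<^sub>M a\<in>A. (lborel :: real measure)) (\<Pi>\<^sub>M b\<in>B. lborel)
        (\<lambda>f. \<lambda>b\<in>B. f (inv_into A g b))) (Pi\<^sub>E B X) = (\<Prod>b\<in>B. emeasure lborel (X b))" .
  qed (use \<open>finite B\<close> in simp_all)
qed

section \<open>Orthonormal bases and the measure on a flat\<close>

lemma orthonormal_basis_of_independent:
  assumes "orthonormal_basis_of B W"
  shows "independent B" "finite B" "card B = dim W"
proof -
  have "0 \<notin> B"
    using assms by (auto simp: orthonormal_basis_of_def)
  then show ind: "independent B"
    using assms by (simp add: orthonormal_basis_of_def pairwise_orthogonal_independent)
  then show "finite B"
    by (rule independent_imp_finite)
  show "card B = dim W"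
    using assms ind by (auto simp: orthonormal_basis_of_def dim_eq_card_independent)
qed

lemma orthonormal_basis_of_inner:
  assumes "orthonormal_basis_of B W" "b \<in> B" "c \<in> B"
  shows "b \<bullet> c = of_bool (b = c)"
proof (cases "b = c")
  case True
  then show ?thesis
    using assms by (simp add: orthonormal_basis_of_def flip: norm_eq_1)
next
  case False
  then show ?thesis
    using assms by (simp add: orthonormal_basis_of_def pairwise_def orthogonal_def)
qed

text \<open>A bijection from \<open>Basis\<close> to \<open>B\<close> extends to an orthogonal map
  \<open>Q\<close>. Thus \<open>flat_lborel p B\<close> is \<open>lborel\<close> pushed forward by
  \<open>Q\<close> and translated by \<open>p\<close>, and neither operation changes it.\<close>

lemma flat_lborel_eq_lborel:
  fixes B :: "(real ^ 'n) set"
  assumes B: "orthonormal_basis_of B UNIV"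
  shows "flat_lborel p B = lborel"
proof -
  have fin: "finite B" and card: "card B = card (Basis :: (real ^ 'n) set)"
    using orthonormal_basis_of_independent[OF B] by simp_all
  obtain g where g: "bij_betw g (Basis :: (real ^ 'n) set) B"
    using fin card by (metis finite_Basis finite_same_card_bij)
  define Q where "Q x = (\<Sum>c\<in>Basis. (x \<bullet> c) *\<^sub>R g c)" for x :: "real ^ 'n"
  have gin: "g c \<in> B" if "c \<in> Basis" for c
    using g that by (auto simp: bij_betw_def)
  have ginj: "g c = g c' \<longleftrightarrow> c = c'" if "c \<in> Basis" "c' \<in> Basis" for c c'
    using g that by (auto simp: bij_betw_def inj_on_def)
  have lin: "linear Q"
    unfolding Q_def by (rule linearI) (simp_all add: inner_simps scaleR_add_left sum.distrib scaleR_sum_right)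
  have "Q x \<bullet> Q y = x \<bullet> y" for x y
  proof -
    have "Q x \<bullet> Q y = (\<Sum>c\<in>Basis. \<Sum>c'\<in>Basis. (x \<bullet> c) * (y \<bullet> c') * (g c \<bullet> g c'))"
      unfolding Q_def by (subst sum.swap) (simp add: inner_sum_left inner_sum_right sum_distrib_left mult_ac)
    also have "\<dots> = (\<Sum>c\<in>Basis. \<Sum>c'\<in>Basis. if c = c' then (x \<bullet> c) * (y \<bullet> c') else 0)"
      by (intro sum.cong refl) (simp add: orthonormal_basis_of_inner[OF B] gin ginj)
    also have "\<dots> = x \<bullet> y"
      by (simp add: euclidean_inner[of x y])
    finally show ?thesis .
  qed
  then have Q: "orthogonal_transformation Q"
    using lin by (simp add: orthogonal_transformation_def)
  have [measurable]: "Q \<in> borel \<rightarrow>\<^sub>M borel"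
    unfolding Q_def by measurable
  have sum_eq: "(\<Sum>b\<in>B. f (inv_into Basis g b) *\<^sub>R b) = Q (\<Sum>c\<in>Basis. f c *\<^sub>R c)"
    for f :: "real ^ 'n \<Rightarrow> real"
  proof -
    have "(\<Sum>b\<in>B. f (inv_into Basis g b) *\<^sub>R b) = (\<Sum>c\<in>Basis. f (inv_into Basis g (g c)) *\<^sub>R g c)"
        by (rule sum.reindex_bij_betw[OF g, symmetric])
    then show ?thesis
      using bij_betw_inv_into_left[OF g] by (simp add: Q_def)
  qed
  have [measurable]: "(\<lambda>f. \<lambda>b\<in>B. f (inv_into Basis g b)) \<in>
      (\<Pi>\<^sub>M a\<in>Basis. (lborel :: real measure)) \<rightarrow>\<^sub>M (\<Pi>\<^sub>M b\<in>B. lborel)"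
    using g by (intro measurable_restrict measurable_component_singleton)
      (metis bij_betw_def inv_into_into)
  have "flat_lborel p B = distr (distr (\<Pi>\<^sub>M c\<in>Basis. (lborel :: real measure)) (\<Pi>\<^sub>M b\<in>B. lborel)
      (\<lambda>f. \<lambda>b\<in>B. f (inv_into Basis g b))) borel (\<lambda>f. p + (\<Sum>b\<in>B. f b *\<^sub>R b))"
    unfolding flat_lborel_def distr_PiM_lborel_reindex[OF g fin] ..
  also have "\<dots> = distr (\<Pi>\<^sub>M c\<in>Basis. (lborel :: real measure)) borel
      (\<lambda>f. p + Q (\<Sum>c\<in>Basis. f c *\<^sub>R c))"
    by (subst distr_distr) (simp_all add: o_def sum_eq)
  also have "\<dots> = distr (distr (distr (\<Pi>\<^sub>M c\<in>Basis. (lborel :: real measure)) borel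
      (\<lambda>f. \<Sum>c\<in>Basis. f c *\<^sub>R c)) borel Q) borel ((+) p)"
    by (simp add: distr_distr o_def)
  also have "\<dots> = lborel"
    unfolding lborel_eq[symmetric] distr_lborel_orthogonal[OF Q] by (rule lborel_distr_plus)
  finally show ?thesis .
qed

text \<open>For a unit vector \<open>n\<close> normal to \<open>X\<close>, the volume of the prism of height \<open>1\<close> is the flat measure of \<open>X\<close>;
  this reduces the measure of facets to determinants.\<close>

definition prism :: "'a::real_vector set \<Rightarrow> 'a \<Rightarrow> 'a set" where
  "prism X n = {y + t *\<^sub>R n |y t. y \<in> X \<and> t \<in> {0..1}}"

lemma emeasure_flat_lborel_prism:
  fixes B :: "(real ^ 'n) set"
  assumes B: "orthonormal_basis_of (insert n B) UNIV" and "n \<notin> B"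
    and X: "X \<in> sets borel" "\<And>x. x \<in> X \<Longrightarrow> n \<bullet> (x - p) = 0"
  shows "emeasure (flat_lborel p B) X = emeasure lborel (prism X n)"
proof -
  interpret product_sigma_finite "\<lambda>_. lborel :: real measure" ..
  have fin: "finite B"
    using orthonormal_basis_of_independent(2)[OF B] by simp
  have n1: "n \<bullet> n = 1" and nB: "\<And>b. b \<in> B \<Longrightarrow> n \<bullet> b = 0"
    using orthonormal_basis_of_inner[OF B] \<open>n \<notin> B\<close> by auto
  \<comment> \<open>The number \<open>n \<bullet> (z - p)\<close> is the height of \<open>z\<close>
    above the flat; subtracting that multiple of \<open>n\<close> recovers the foot point. In this
    form measurability of the prism is immediate.\<close>
  have prism_iff: "z \<in> prism X n \<longleftrightarrow> z - (n \<bullet> (z - p)) *\<^sub>R n \<in> X \<and> n \<bullet> (z - p) \<in> {0..1}" for z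
  proof
    assume "z \<in> prism X n"
    then obtain y t where y: "z = y + t *\<^sub>R n" "y \<in> X" "t \<in> {0..1}"
      by (auto simp: prism_def)
    then have "n \<bullet> (z - p) = t"
      using X(2)[of y] by (simp add: inner_simps n1)
    then show "z - (n \<bullet> (z - p)) *\<^sub>R n \<in> X \<and> n \<bullet> (z - p) \<in> {0..1}"
      using y by simp
  next
    assume "z - (n \<bullet> (z - p)) *\<^sub>R n \<in> X \<and> n \<bullet> (z - p) \<in> {0..1}"
    then show "z \<in> prism X n"
      unfolding prism_def by (intro CollectI exI[of _ "z - (n \<bullet> (z - p)) *\<^sub>R n"] exI[of _ "n \<bullet> (z - p)"]) simp
  qed
  have meas [measurable]: "prism X n \<in> sets borel"
  proof -
    have "prism X n = {z \<in> space borel. z - (n \<bullet> (z - p)) *\<^sub>R n \<in> X \<and> n \<bullet> (z - p) \<in> {0..1}}"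
      using prism_iff by auto
    also have "\<dots> \<in> sets borel"
      using X(1) by measurable
    finally show ?thesis .
  qed
  let ?F = "\<lambda>f. p + (\<Sum>b\<in>B. f b *\<^sub>R b)" and ?G = "\<lambda>f. p + (\<Sum>b\<in>insert n B. f b *\<^sub>R b)"
  have inner_F: "n \<bullet> (?F f - p) = 0" for f
    by (simp add: inner_sum_right nB)
  have F_upd: "?F (f(n := t)) = ?F f" for f t
    using \<open>n \<notin> B\<close> by (auto intro!: sum.cong)
  have G_upd: "?G (f(n := t)) = ?F f + t *\<^sub>R n" for f t
    using F_upd[of f t] fin \<open>n \<notin> B\<close> by simp
  \<comment> \<open>In the coordinate \<open>t\<close> along \<open>n\<close> the indicator of the
    prism factors, so in Fubini's theorem the inner integral contributes only the length 1 of the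
    interval.\<close>
  have ind: "indicator (prism X n) (?G (f(n := t))) = (indicator X (?F f) * indicator {0..1} t :: ennreal)" for f t
  proof -
    have "n \<bullet> (?G (f(n := t)) - p) = t"
      unfolding G_upd using inner_F[of f] by (simp add: inner_simps n1)
    then have "?G (f(n := t)) \<in> prism X n \<longleftrightarrow> ?F f \<in> X \<and> t \<in> {0..1}"
      unfolding prism_iff by (simp only:) (simp only: G_upd add_diff_cancel_right')
    then show ?thesis
      by (simp add: indicator_def)
  qed
  have "emeasure lborel (prism X n) = (\<integral>\<^sup>+z. indicator (prism X n) z \<partial>flat_lborel p (insert n B))"
    unfolding flat_lborel_eq_lborel[OF B] by simp
  also have "\<dots> = (\<integral>\<^sup>+f. indicator (prism X n) (?G f) \<partial>(\<Pi>\<^sub>M b\<in>insert n B. lborel))"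
    unfolding flat_lborel_def by (subst nn_integral_distr) simp_all
  also have "\<dots> = (\<integral>\<^sup>+f. (\<integral>\<^sup>+t. indicator (prism X n) (?G (f(n := t))) \<partial>lborel) \<partial>(\<Pi>\<^sub>M b\<in>B. lborel))"
    using fin \<open>n \<notin> B\<close> by (intro product_nn_integral_insert) simp_all
  also have "\<dots> = (\<integral>\<^sup>+f. indicator X (?F f) \<partial>(\<Pi>\<^sub>M b\<in>B. lborel))"
    unfolding ind by (simp add: nn_integral_cmult)
  also have "\<dots> = (\<integral>\<^sup>+z. indicator X z \<partial>flat_lborel p B)"
    unfolding flat_lborel_def using X(1) by (subst nn_integral_distr) simp_all
  also have "\<dots> = emeasure (flat_lborel p B) X"
    using X(1) by (simp add: flat_lborel_def)
  finally show ?thesis ..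
qed

section \<open>Directions and facet normals\<close>

lemma subspace_directions: "subspace (directions X)"
  by (simp add: directions_def)

lemma diff_in_directions: "x \<in> X \<Longrightarrow> y \<in> X \<Longrightarrow> x - y \<in> directions X"
  unfolding directions_def by (rule span_base) blast

lemma directions_mono: "X \<subseteq> Y \<Longrightarrow> directions X \<subseteq> directions Y"
  unfolding directions_def by (rule span_mono) blast

text \<open>A translate of the subspace \<open>directions X\<close> is convex and contains
  \<open>X\<close>, hence contains the hull.\<close>

lemma directions_convex_hull: "directions (convex hull X) = directions X"
proof
  show "directions X \<subseteq> directions (convex hull X)"
    by (rule directions_mono) (rule hull_subset)
  have "x - y \<in> directions X" if "x \<in> convex hull X" "y \<in> convex hull X" for x y
  proof -
    obtain b where b: "b \<in> X"
      using \<open>x \<in> convex hull X\<close> by (metis convex_hull_empty emptyE equals0I)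
    have "convex ((+) b ` directions X)"
      by (intro convex_translation subspace_imp_convex subspace_directions)
    moreover have "X \<subseteq> (+) b ` directions X"
    proof
      fix z assume "z \<in> X"
      then show "z \<in> (+) b ` directions X"
        using diff_in_directions[OF _ b] by (intro image_eqI[of _ _ "z - b"]) auto
    qed
    ultimately have "convex hull X \<subseteq> (+) b ` directions X"
      by (simp add: hull_minimal)
    then obtain u v where "u \<in> directions X" "v \<in> directions X" "x = b + u" "y = b + v"
      using \<open>x \<in> convex hull X\<close> \<open>y \<in> convex hull X\<close> by blast
    then show ?thesis
      using subspace_diff[OF subspace_directions] by (metis add_diff_cancel_left)
  qed
  then show "directions (convex hull X) \<subseteq> directions X"
    unfolding directions_def[of "convex hull X"]
    by (intro span_minimal subspace_directions) blast
qed

text \<open>Supplies a decomposition used repeatedly: a direction of a simplex is a multiple of one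
  apex edge plus a direction of the opposite facet.\<close>

lemma directions_insert:
  assumes "b \<in> X"
  shows "directions (insert a X) = span (insert (a - b) (directions X))"
proof
  let ?S = "span (insert (a - b) (directions X))"
  have sub: "directions X \<subseteq> ?S" "a - b \<in> ?S"
    by (auto intro: span_base)
  have *: "x - b \<in> ?S" if "x \<in> insert a X" for x
    using that sub diff_in_directions[OF _ assms] by blast
  have "x - y \<in> ?S" if "x \<in> insert a X" "y \<in> insert a X" for x y
    using span_diff[OF *[OF that(1)] *[OF that(2)]] by simp
  then show "directions (insert a X) \<subseteq> ?S"
    unfolding directions_def[of "insert a X"] by (intro span_minimal) auto
  show "?S \<subseteq> directions (insert a X)"
    using assms directions_mono[of X "insert a X"]
    by (intro span_minimal subspace_directions) (auto intro: diff_in_directions)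
qed

lemma apex_notin_directions:
  assumes "\<not> affine_dependent V" "a \<in> V" "b \<in> V - {a}"
  shows "a - b \<notin> directions (V - {a})"
proof
  assume "a - b \<in> directions (V - {a})"
  let ?S = "span ((\<lambda>x. - b + x) ` (V - {a} - {b}))"
  have *: "x - b \<in> ?S" if "x \<in> V - {a}" for x
  proof (cases "x = b")
    case False
    then show ?thesis
      using that by (intro span_base image_eqI[of _ _ x]) auto
  qed (simp add: span_zero)
  have "x - y \<in> ?S" if "x \<in> V - {a}" "y \<in> V - {a}" for x y
    using span_diff[OF *[OF that(1)] *[OF that(2)]] by simp
  then have "directions (V - {a}) \<subseteq> ?S"
    unfolding directions_def by (intro span_minimal) auto
  then have "a \<in> affine hull (V - {a})"
    unfolding affine_hull_span2[OF assms(3)]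
    using \<open>a - b \<in> directions (V - {a})\<close> by (intro image_eqI[of _ _ "a - b"]) auto
  then show False
    using assms(1,2) by (auto simp: affine_dependent_def)
qed

definition facet_normal :: "'a::euclidean_space set \<Rightarrow> 'a \<Rightarrow> 'a" where
  "facet_normal V a = outward_normal (convex hull V) (convex hull (V - {a}))"

lemma orthogonal_directions:
  assumes "\<And>x y. x \<in> X \<Longrightarrow> y \<in> X \<Longrightarrow> n \<bullet> (x - y) = 0" "z \<in> directions X"
  shows "n \<bullet> z = 0"
proof -
  have "span {x - y |x y. x \<in> X \<and> y \<in> X} \<subseteq> {z. n \<bullet> z = 0}"
    using assms(1) by (intro span_minimal subspace_hyperplane) blast
  then show ?thesis
    using assms(2) by (auto simp: directions_def)
qed

text \<open>Linear conditions on hulls need testing only at vertices. Since \<open>n\<close>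
  vanishes on the facet directions, it has the same product with every apex edge, so one sign
  condition remains.\<close>

lemma is_outward_normal_iff:
  assumes a: "a \<in> V" and b: "b \<in> V - {a}"
  shows "is_outward_normal (convex hull V) (convex hull (V - {a})) n \<longleftrightarrow>
    n \<in> directions V \<and> norm n = 1 \<and> (\<forall>z\<in>directions (V - {a}). n \<bullet> z = 0) \<and> n \<bullet> (a - b) \<le> 0"
proof -
  have b': "b \<in> convex hull (V - {a})" and a': "a \<in> convex hull V"
    using a b by (auto intro: hull_inc)
  have "n \<bullet> (x - y) \<le> 0"
    if n: "\<And>z. z \<in> directions (V - {a}) \<Longrightarrow> n \<bullet> z = 0" "n \<bullet> (a - b) \<le> 0"
      and x: "x \<in> convex hull V" and y: "y \<in> convex hull (V - {a})" for x y
  proof -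
    have "n \<bullet> v \<le> n \<bullet> b" if "v \<in> V" for v
      using n(1)[of "v - b"] n(2) b that diff_in_directions[of v "V - {a}" b]
      by (cases "v = a") (auto simp: inner_diff_right)
    then have "convex hull V \<subseteq> {x. n \<bullet> x \<le> n \<bullet> b}"
      by (intro hull_minimal convex_halfspace_le) auto
    moreover have "n \<bullet> (y - b) = 0"
      using y b' by (intro n(1)) (metis diff_in_directions directions_convex_hull)
    ultimately show ?thesis
      using x by (auto simp: inner_diff_right)
  qed
  moreover have "n \<bullet> z = 0"
    if "\<forall>x\<in>convex hull (V - {a}). \<forall>y\<in>convex hull (V - {a}). n \<bullet> (x - y) = 0" "z \<in> directions (V - {a})" for z
    using that orthogonal_directions[of "convex hull (V - {a})" n z] by (simp add: directions_convex_hull)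
  moreover have "n \<bullet> (x - y) = 0"
    if "\<forall>z\<in>directions (V - {a}). n \<bullet> z = 0" "x \<in> convex hull (V - {a})" "y \<in> convex hull (V - {a})" for x y
    using that by (metis diff_in_directions directions_convex_hull)
  ultimately show ?thesis
    unfolding is_outward_normal_def directions_convex_hull using a' b' by blast
qed

text \<open>The component \<open>q\<close> of \<open>a - b\<close> orthogonal to the facet
  directions determines the normal up to a factor; norm and sign then force \<open>q\<close> divided
  by \<open>- norm q\<close>, because \<open>q \<bullet> (a - b)\<close> is positive.\<close>

lemma ex1_outward_normal:
  fixes V :: "'a::euclidean_space set"
  assumes V: "\<not> affine_dependent V" and a: "a \<in> V" and b: "b \<in> V - {a}"
  shows "\<exists>!n. is_outward_normal (convex hull V) (convex hull (V - {a})) n"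
proof -
  let ?W = "directions (V - {a})"
  have W: "span ?W = ?W"
    by (simp add: subspace_directions)
  obtain p q where p: "p \<in> span ?W" and q: "\<And>w. w \<in> span ?W \<Longrightarrow> orthogonal q w" and ab: "a - b = p + q"
    by (metis orthogonal_subspace_decomp_exists)
  have dirV: "directions V = span (insert (a - b) ?W)"
    using directions_insert[OF b, of a] a by (simp add: insert_absorb)
  have "q \<noteq> 0"
    using p ab apex_notin_directions[OF V a b] W by auto
  have q_dir: "q \<in> directions V"
  proof -
    have "q = (a - b) - p"
      using ab by simp
    moreover have "p \<in> span (insert (a - b) ?W)"
      using p span_mono[of ?W "insert (a - b) ?W"] by auto
    ultimately show ?thesis
      unfolding dirV by (simp add: span_base span_diff)
  qed
  have qab: "q \<bullet> (a - b) = q \<bullet> q"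
    using q[OF p] by (simp add: ab inner_add_right orthogonal_def)
  have qq: "q \<bullet> q > 0"
    using \<open>q \<noteq> 0\<close> by simp
  show ?thesis
  proof (rule ex1I)
    show "is_outward_normal (convex hull V) (convex hull (V - {a})) (- (1 / norm q) *\<^sub>R q)"
      unfolding is_outward_normal_iff[OF a b]
      using \<open>q \<noteq> 0\<close> q q_dir W qab qq
      by (auto simp: orthogonal_def intro!: subspace_scale subspace_neg[OF subspace_directions] subspace_directions)
  next
    fix n assume "is_outward_normal (convex hull V) (convex hull (V - {a})) n"
    then have n: "n \<in> directions V" "norm n = 1" "\<And>z. z \<in> ?W \<Longrightarrow> n \<bullet> z = 0" "n \<bullet> (a - b) \<le> 0"
      unfolding is_outward_normal_iff[OF a b] by auto
    obtain k where k: "n - k *\<^sub>R (a - b) \<in> ?W"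
      using n(1) unfolding dirV span_insert W by blast
    have "n - k *\<^sub>R q = (n - k *\<^sub>R (a - b)) + k *\<^sub>R p"
      using ab by (simp add: algebra_simps)
    \<comment> \<open>This difference is a facet direction, while \<open>n\<close> and
      \<open>q\<close> are both orthogonal to such directions; hence it is orthogonal to itself and
      vanishes.\<close>
    then have nkq: "n - k *\<^sub>R q \<in> ?W"
      using k p W by (metis subspace_add subspace_directions subspace_scale)
    then have "(n - k *\<^sub>R q) \<bullet> (n - k *\<^sub>R q) = 0"
      using n(3)[OF nkq] q[of "n - k *\<^sub>R q"] W by (simp add: inner_diff_left orthogonal_def)
    then have nk: "n = k *\<^sub>R q"
      by simp
    then have "k \<le> 0"
      using n(4) qab qq by (simp add: mult_le_0_iff)
    moreover have "\<bar>k\<bar> * norm q = 1"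
      using n(2) nk by simp
    ultimately have "k = - (1 / norm q)"
      using \<open>q \<noteq> 0\<close> by (simp add: field_simps)
    then show "n = - (1 / norm q) *\<^sub>R q"
      using nk by simp
  qed
qed

text \<open>Unique existence hands the defining properties to the \<open>THE\<close> in
  \<open>outward_normal\<close>. The last inequality is strict, since otherwise the normal would be
  orthogonal to all of \<open>directions V\<close>, hence to itself, despite its norm 1.\<close>

lemma facet_normal:
  fixes V :: "'a::euclidean_space set"
  assumes V: "\<not> affine_dependent V" and a: "a \<in> V" and b: "b \<in> V - {a}"
  shows "facet_normal V a \<in> directions V" "norm (facet_normal V a) = 1"
    "z \<in> directions (V - {a}) \<Longrightarrow> facet_normal V a \<bullet> z = 0"
    "facet_normal V a \<bullet> (a - b) < 0"
proof -
  have "is_outward_normal (convex hull V) (convex hull (V - {a})) (facet_normal V a)"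
    unfolding facet_normal_def outward_normal_def by (rule theI') (rule ex1_outward_normal[OF assms])
  then have n: "facet_normal V a \<in> directions V" "norm (facet_normal V a) = 1"
      "\<And>z. z \<in> directions (V - {a}) \<Longrightarrow> facet_normal V a \<bullet> z = 0" "facet_normal V a \<bullet> (a - b) \<le> 0"
    unfolding is_outward_normal_iff[OF a b] by auto
  then show "facet_normal V a \<in> directions V" "norm (facet_normal V a) = 1"
    "z \<in> directions (V - {a}) \<Longrightarrow> facet_normal V a \<bullet> z = 0" by auto
  have "facet_normal V a \<bullet> (a - b) \<noteq> 0"
  proof
    assume 0: "facet_normal V a \<bullet> (a - b) = 0"
    have "directions V = span (insert (a - b) (directions (V - {a})))"
      using directions_insert[OF b, of a] a by (simp add: insert_absorb)
    also have "\<dots> \<subseteq> {z. facet_normal V a \<bullet> z = 0}"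
      using 0 n(3) by (intro span_minimal subspace_hyperplane) auto
    finally show False
      using n(1,2) by (force simp: norm_eq_sqrt_inner)
  qed
  then show "facet_normal V a \<bullet> (a - b) < 0"
    using n(4) by simp
qed

section \<open>The \<open>d\<close>-sine in terms of the dual basis\<close>

lemma sum_axis_scaleR:
  fixes v :: "'n::finite \<Rightarrow> 'a::real_vector"
  shows "(\<Sum>j\<in>UNIV. (axis i 1 :: real ^ 'n) $ j *\<^sub>R v j) = v i"
proof -
  have "(\<Sum>j\<in>UNIV. (axis i 1 :: real ^ 'n) $ j *\<^sub>R v j) = (\<Sum>j\<in>UNIV. if j = i then v j else 0)"
    by (rule sum.cong) (auto simp: axis_def)
  then show ?thesis
    by simp
qed

lemma linear_sum_scaleR:
  fixes v :: "'n::finite \<Rightarrow> real ^ 'm"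
  shows "linear (\<lambda>x :: real ^ 'n. \<Sum>j\<in>UNIV. x $ j *\<^sub>R v j)"
  by (intro linear_compose_sum ballI linearI) (simp_all add: scaleR_left_distrib)

text \<open>The map sends the coordinate vectors to the \<open>v i\<close>, which are thus the
  columns of its matrix; transposing gives the matrix with rows \<open>v i\<close> used
  throughout.\<close>

lemma measure_sum_scaleR_image:
  fixes v :: "'n \<Rightarrow> real ^ 'n"
  assumes "S \<in> lmeasurable"
  shows "measure lebesgue ((\<lambda>x. \<Sum>j\<in>UNIV. x $ j *\<^sub>R v j) ` S)
    = \<bar>det (\<chi> i. v i)\<bar> * measure lebesgue S"
proof -
  have "matrix (\<lambda>x :: real ^ 'n. \<Sum>j\<in>UNIV. x $ j *\<^sub>R v j) = transpose (\<chi> i. v i)"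
    by (simp add: matrix_def transpose_def vec_eq_iff sum_axis_scaleR del: sum_component)
  then show ?thesis
    using measure_linear_image_cart[OF linear_sum_scaleR assms] by (simp add: det_transpose)
qed

text \<open>The simplex is the linear image of the standard simplex, whose volume is the reciprocal
  of the factorial of the dimension.\<close>

lemma measure_simplex:
  fixes v :: "'n \<Rightarrow> real ^ 'n"
  shows "measure lebesgue (convex hull (insert 0 (range v))) = \<bar>det (\<chi> i. v i)\<bar> / fact CARD('n)"
proof -
  let ?f = "\<lambda>x :: real ^ 'n. \<Sum>j\<in>UNIV. x $ j *\<^sub>R v j"
  let ?S = "convex hull (insert 0 Basis) :: (real ^ 'n) set"
  have comp: "compact ?S"
    by (intro finite_imp_compact_convex_hull) auto
  have Basis: "(Basis :: (real ^ 'n) set) = range (\<lambda>i. axis i 1)"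
    by (auto simp: Basis_vec_def)
  have "?f ` Basis = range v"
    unfolding Basis image_image sum_axis_scaleR ..
  then have "?f ` ?S = convex hull (insert 0 (range v))"
    by (simp add: convex_hull_linear_image[OF linear_sum_scaleR])
  then have "measure lebesgue (convex hull (insert 0 (range v))) = \<bar>det (\<chi> i. v i)\<bar> * measure lebesgue ?S"
    using measure_sum_scaleR_image[of ?S v] comp by (simp add: lmeasurable_compact)
  also have "measure lebesgue ?S = measure lborel ?S"
    using comp by (intro measure_completion) (auto dest: compact_imp_closed)
  finally show ?thesis
    by (simp add: content_std_simplex)
qed

section \<open>Prisms over simplices and the measure of facets\<close>

lemma compact_prism:
  fixes X :: "'a::real_normed_vector set"
  assumes "compact X"
  shows "compact (prism X n)"
proof -
  have "prism X n = (\<lambda>(y, t). y + t *\<^sub>R n) ` (X \<times> {0..1})"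
    by (force simp: prism_def)
  moreover have "compact ((\<lambda>(y, t). y + t *\<^sub>R n) ` (X \<times> {0..1}))"
    unfolding case_prod_unfold using assms
    by (intro compact_continuous_image compact_Times continuous_intros) auto
  ultimately show ?thesis
    by simp
qed

lemma linear_image_prism:
  assumes "linear f"
  shows "f ` prism X n = prism (f ` X) (f n)"
proof -
  have f: "f (y + t *\<^sub>R n) = f y + t *\<^sub>R f n" for y t
    by (simp add: linear_add[OF assms] linear_scale[OF assms])
  then show ?thesis
    unfolding prism_def by (blast intro: f[symmetric])
qed

text \<open>The base is a standard simplex of dimension one less than the space; in the coordinates
  of \<open>flat_lborel\<close> it becomes the set measured by
  \<open>emeasure_std_simplex_aux\<close>.\<close>

lemma measure_std_prism:
  fixes i :: "'n::finite"
  shows "measure lebesgue (prism (convex hull (insert 0 ((\<lambda>k. axis k 1) ` (- {i})))) (axis i 1 :: real ^ 'n))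
    = 1 / fact (CARD('n) - 1)"
proof -
  let ?e = "axis i 1 :: real ^ 'n"
  define B where "B = (Basis :: (real ^ 'n) set) - {?e}"
  let ?X = "convex hull (insert 0 B)"
  have eB: "?e \<in> Basis"
    by simp
  have B_eq: "(\<lambda>k. axis k 1) ` (- {i}) = B"
    by (auto simp: B_def Basis_vec_def axis_eq_axis)
  have finB: "finite B" and Bsub: "B \<subseteq> Basis" and "insert ?e B = Basis"
    using eB by (auto simp: B_def)
  have card: "card B = CARD('n) - 1"
    unfolding B_def using eB by (subst card_Diff_singleton) auto
  have ob: "orthonormal_basis_of (insert ?e B) UNIV"
    unfolding \<open>insert ?e B = Basis\<close> orthonormal_basis_of_def
    by (auto simp: pairwise_def orthogonal_def inner_Basis)
  have X: "?X = {x. (\<forall>b\<in>Basis. 0 \<le> x \<bullet> b) \<and> (\<Sum>b\<in>B. x \<bullet> b) \<le> 1 \<and> (\<forall>b\<in>Basis. b \<notin> B \<longrightarrow> x \<bullet> b = 0)}"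
    by (rule substd_simplex[OF Bsub])
  have comp: "compact ?X"
    using finB by (intro finite_imp_compact_convex_hull) auto
  have Xb: "?X \<in> sets borel"
    using comp by (intro borel_closed compact_imp_closed)
  have inner: "(\<Sum>c\<in>B. f c *\<^sub>R c) \<bullet> b = (if b \<in> B then f b else 0)" if "b \<in> Basis" for f :: "real ^ 'n \<Rightarrow> real" and b
  proof -
    have "(\<Sum>c\<in>B. f c *\<^sub>R c) \<bullet> b = (\<Sum>c\<in>B. if c = b then f c else 0)"
      unfolding inner_sum_left using that Bsub by (intro sum.cong refl) (auto simp: inner_Basis)
    then show ?thesis
      using finB by simp
  qed
  have mem: "(\<Sum>c\<in>B. f c *\<^sub>R c) \<in> ?X \<longleftrightarrow> (\<forall>b\<in>B. 0 \<le> f b) \<and> sum f B \<le> 1" for f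
  proof -
    have "(\<Sum>b\<in>B. (\<Sum>c\<in>B. f c *\<^sub>R c) \<bullet> b) = sum f B"
      using Bsub by (intro sum.cong) (auto simp: inner)
    then show ?thesis
      unfolding X using Bsub by (auto simp: inner)
  qed
  have "emeasure lborel (prism ?X ?e) = emeasure (flat_lborel 0 B) ?X"
  proof (rule emeasure_flat_lborel_prism[OF ob _ Xb, symmetric])
    have "?e \<notin> B"
      by (simp add: B_def)
    then show "?e \<bullet> (x - 0) = 0" if "x \<in> ?X" for x
      using that eB by (auto simp: X inner_commute)
  qed (simp add: B_def)
  also have "\<dots> = emeasure (\<Pi>\<^sub>M b\<in>B. lborel) ((\<lambda>f. \<Sum>b\<in>B. f b *\<^sub>R b) -` ?X \<inter> space (\<Pi>\<^sub>M b\<in>B. lborel))"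
    unfolding flat_lborel_def using Xb by (subst emeasure_distr) simp_all
  also have "(\<lambda>f. \<Sum>b\<in>B. f b *\<^sub>R b) -` ?X = {f. (\<forall>b\<in>B. 0 \<le> f b) \<and> sum f B \<le> 1}"
    by (auto simp: mem)
  also have "emeasure (\<Pi>\<^sub>M b\<in>B. (lborel :: real measure)) ({f. (\<forall>b\<in>B. 0 \<le> f b) \<and> sum f B \<le> 1} \<inter> space (\<Pi>\<^sub>M b\<in>B. lborel))
      = ennreal (1 / fact (CARD('n) - 1))"
    using emeasure_std_simplex_aux[OF finB, of 1] by (simp add: card)
  finally have "emeasure lborel (prism ?X ?e) = ennreal (1 / fact (CARD('n) - 1))" .
  then have "measure lborel (prism ?X ?e) = 1 / fact (CARD('n) - 1)"
    by (simp add: measure_def)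
  moreover have "measure lebesgue (prism ?X ?e) = measure lborel (prism ?X ?e)"
    using compact_imp_closed[OF compact_prism[OF comp]] by (intro measure_completion) simp
  ultimately show ?thesis
    by (simp add: B_eq)
qed

lemma directions_insert_0: "directions (insert 0 X) = span X"
proof
  show "directions (insert 0 X) \<subseteq> span X"
    unfolding directions_def by (intro span_minimal subspace_span) (auto intro: span_base span_diff span_neg span_zero)
  show "span X \<subseteq> directions (insert 0 X)"
    using diff_in_directions[of _ "insert 0 X" 0] by (intro span_minimal subspace_directions) force
qed

text \<open>The prism over the facet in direction \<open>n\<close> is a linear image of the standard
  prism, which brings in the determinant with \<open>n\<close> in row \<open>i\<close>. As
  \<open>n\<close> is a unit normal, the volume of this prism is the measure of the facet.\<close>

lemma flat_measure_facet:
  fixes v :: "'n \<Rightarrow> real ^ 'n"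
  assumes det: "det (\<chi> k. if k = i then n else v k) \<noteq> 0"
    and n: "norm n = 1" "\<And>k. k \<noteq> i \<Longrightarrow> n \<bullet> v k = 0"
  shows "flat_measure (convex hull (insert 0 (v ` (- {i}))))
    = \<bar>det (\<chi> k. if k = i then n else v k)\<bar> / fact (CARD('n) - 1)"
proof -
  define u where "u k = (if k = i then n else v k)" for k
  let ?X = "convex hull (insert 0 (v ` (- {i})))"
  let ?E = "convex hull (insert 0 ((\<lambda>k. axis k 1) ` (- {i}))) :: (real ^ 'n) set"
  let ?f = "\<lambda>x :: real ^ 'n. \<Sum>j\<in>UNIV. x $ j *\<^sub>R u j"
  have dir: "directions ?X = span (v ` (- {i}))"
    by (simp add: directions_convex_hull directions_insert_0)
  \<comment> \<open>\<open>p\<close> and \<open>B\<close> are the choices made inside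
    \<open>flat_measure\<close>; only properties common to all admissible choices are used.\<close>
  define p where "p = (SOME p. p \<in> ?X)"
  define B where "B = (SOME B. orthonormal_basis_of B (directions ?X))"
  have p: "p \<in> ?X"
    unfolding p_def by (rule someI[of _ 0]) (simp add: hull_inc)
  have B: "orthonormal_basis_of B (directions ?X)"
    unfolding B_def
  proof (rule someI_ex)
    show "\<exists>B. orthonormal_basis_of B (directions ?X)"
      unfolding orthonormal_basis_of_def using orthonormal_basis_subspace[OF subspace_directions] by metis
  qed
  have n_dir: "n \<bullet> x = 0" if "x \<in> directions ?X" for x
  proof -
    have "span (v ` (- {i})) \<subseteq> {x. n \<bullet> x = 0}"
      using n(2) by (intro span_minimal subspace_hyperplane) auto
    then show ?thesis
      using that dir by blast
  qed
  have BX: "b \<in> directions ?X" if "b \<in> B" for b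
    using B that by (auto simp: orthonormal_basis_of_def intro: span_base)
  have "n \<notin> B"
    using n(1) n_dir BX by (metis norm_eq_1 zero_neq_one)
  \<comment> \<open>The rows \<open>u k\<close> span the space because their determinant is nonzero,
    and each of them is \<open>n\<close> or lies in the span of \<open>B\<close>.\<close>
  have "span (insert n B) = UNIV"
  proof -
    have "rows (\<chi> k. u k) = range u"
      by (auto simp: rows_def row_def)
    moreover have "span (rows (\<chi> k. u k)) = UNIV"
      using det unfolding u_def
      by (metis invertible_det_nz invertible_def matrix_left_invertible_span_rows)
    moreover have "range u \<subseteq> span (insert n B)"
    proof clarify
      fix k
      have "span B = span (v ` (- {i}))"
        using B dir by (simp add: orthonormal_basis_of_def)
      then have "v k \<in> span B" if "k \<noteq> i"
        using that by (auto intro: span_base)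
      then show "u k \<in> span (insert n B)"
        using span_mono[of B "insert n B"] by (auto simp: u_def intro: span_base)
    qed
    ultimately show ?thesis
      by (metis span_minimal subspace_span top.extremum_uniqueI)
  qed
  then have ob: "orthonormal_basis_of (insert n B) UNIV"
    using B n(1) n_dir BX
    by (auto simp: orthonormal_basis_of_def pairwise_insert orthogonal_def inner_commute)
  have comp: "compact ?X" "compact ?E"
    by (intro finite_imp_compact_convex_hull; simp)+
  have Xb: "?X \<in> sets borel"
    using comp(1) by (intro borel_closed compact_imp_closed)
  have "emeasure (flat_lborel p B) ?X = emeasure lborel (prism ?X n)"
    by (rule emeasure_flat_lborel_prism[OF ob \<open>n \<notin> B\<close> Xb]) (intro n_dir diff_in_directions p)
  then have "flat_measure ?X = measure lborel (prism ?X n)"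
    by (simp add: flat_measure_def measure_def p_def B_def)
  also have "\<dots> = measure lebesgue (prism ?X n)"
    using compact_imp_closed[OF compact_prism[OF comp(1)]] by (intro measure_completion[symmetric]) simp
  also have "prism ?X n = ?f ` prism ?E (axis i 1)"
  proof -
    have "u ` (- {i}) = v ` (- {i})" "u i = n"
      by (auto simp: u_def)
    then have "?f ` ?E = ?X"
      unfolding convex_hull_linear_image[OF linear_sum_scaleR]
      by (simp add: image_image sum_axis_scaleR)
    then show ?thesis
      unfolding linear_image_prism[OF linear_sum_scaleR] sum_axis_scaleR \<open>u i = n\<close> by simp
  qed
  also have "measure lebesgue \<dots> = \<bar>det (\<chi> k. u k)\<bar> * measure lebesgue (prism ?E (axis i 1))"
    using compact_prism[OF comp(2)] by (intro measure_sum_scaleR_image lmeasurable_compact)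
  finally show ?thesis
    by (simp add: measure_std_prism u_def)
qed

section \<open>Dual bases and the formula for the \<open>d\<close>-sine\<close>

lemma dual_basis_expansion:
  fixes v w :: "'n \<Rightarrow> real ^ 'n"
  assumes dual: "\<And>i j. v i \<bullet> w j = of_bool (i = j)"
  shows "(\<Sum>k\<in>UNIV. (x \<bullet> w k) *\<^sub>R v k) = x"
    and "det (\<chi> i. v i) * det (\<chi> i. w i) = 1"
proof -
  \<comment> \<open>The matrix with rows \<open>v i\<close> times the matrix with columns
    \<open>w j\<close> is the identity; exchanging the two factors yields the expansion.\<close>
  have AW: "(\<chi> i. v i) ** transpose (\<chi> i. w i) = mat 1"
    using dual by (simp add: matrix_matrix_mult_def transpose_def mat_def vec_eq_iff inner_vec_def of_bool_def)
  then show "det (\<chi> i. v i) * det (\<chi> i. w i) = 1"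
    by (metis det_I det_mul det_transpose)
  have "transpose (\<chi> i. w i) ** (\<chi> i. v i) = mat 1"
    using AW matrix_left_right_inverse by blast
  then have WA: "(\<Sum>k\<in>UNIV. w k $ m * v k $ l) = (if m = l then 1 else 0)" for m l
    by (simp add: matrix_matrix_mult_def transpose_def mat_def vec_eq_iff)
  show "(\<Sum>k\<in>UNIV. (x \<bullet> w k) *\<^sub>R v k) = x"
  proof (simp only: vec_eq_iff, rule allI)
    fix l
    have "(\<Sum>k\<in>UNIV. (x \<bullet> w k) *\<^sub>R v k) $ l = (\<Sum>k\<in>UNIV. \<Sum>m\<in>UNIV. x $ m * (w k $ m * v k $ l))"
      by (simp add: inner_vec_def sum_distrib_left mult_ac)
    also have "\<dots> = (\<Sum>m\<in>UNIV. x $ m * (\<Sum>k\<in>UNIV. w k $ m * v k $ l))"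
      by (subst sum.swap) (simp add: sum_distrib_left)
    also have "\<dots> = x $ l"
      by (simp add: WA if_distrib cong: if_cong)
    finally show "(\<Sum>k\<in>UNIV. (x \<bullet> w k) *\<^sub>R v k) $ l = x $ l" .
  qed
qed

text \<open>Cramer's rule: the coordinates of \<open>x\<close> in the basis \<open>v\<close> are the
  products \<open>x \<bullet> w k\<close>.\<close>

lemma det_replace_row_dual:
  fixes v w :: "'n \<Rightarrow> real ^ 'n"
  assumes dual: "\<And>i j. v i \<bullet> w j = of_bool (i = j)"
  shows "det (\<chi> k. if k = i then x else v k) = (x \<bullet> w i) * det (\<chi> i. v i)"
proof -
  have "(\<Sum>k\<in>UNIV. (\<chi> k. x \<bullet> w k) $ k *s row k (\<chi> i. v i)) = x"
    using dual_basis_expansion(1)[OF dual, of x] by (simp add: row_def scalar_mult_eq_scaleR)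
  moreover have "row k (\<chi> i. v i) = v k" for k
    by (simp add: row_def)
  ultimately show ?thesis
    using cramer_lemma_transpose[of i "\<chi> k. x \<bullet> w k" "\<chi> i. v i"] by (simp only: vec_lambda_beta)
qed

lemma dual_basis_independent:
  assumes dual: "\<And>i j. v i \<bullet> w j = of_bool (i = j)"
  shows "inj v" "independent (range v)"
proof -
  show "inj v"
  proof
    fix i j assume "v i = v j"
    then show "i = j"
      using dual[of i i] dual[of j i] by (metis of_bool_eq_0_iff zero_neq_one of_bool_eq_1_iff)
  qed
  show "independent (range v)"
  proof
    assume "dependent (range v)"
    then obtain i where "v i \<in> span (range v - {v i})"
      unfolding dependent_def by blast
    moreover have "span (range v - {v i}) \<subseteq> {x. w i \<bullet> x = 0}"
      using dual by (intro span_minimal subspace_hyperplane) (auto simp: inner_commute)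
    ultimately show False
      using dual[of i i] by (auto simp: inner_commute)
  qed
qed

text \<open>The vector \<open>w j\<close> represents a linear functional that is 1 at
  \<open>v j\<close> and 0 at the other \<open>v i\<close>.\<close>

lemma ex_dual_basis:
  fixes v :: "'n::finite \<Rightarrow> 'a::euclidean_space"
  assumes "inj v" "independent (range v)"
  shows "\<exists>w. \<forall>i j. v i \<bullet> w j = of_bool (i = j)"
proof -
  have "\<exists>w. \<forall>i. v i \<bullet> w = of_bool (i = j)" for j
  proof -
    obtain f :: "'a \<Rightarrow> real" where f: "linear f" "\<forall>x\<in>range v. f x = of_bool (x = v j)"
      using linear_independent_extend[OF assms(2), of "\<lambda>x. of_bool (x = v j)"] by blast
    have "v i \<bullet> adjoint f 1 = of_bool (i = j)" for i
      using f(2) adjoint_works[OF f(1), of "v i" 1] \<open>inj v\<close> by (simp add: inj_eq)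
    then show ?thesis
      by blast
  qed
  then show ?thesis
    by metis
qed

text \<open>The facet opposite \<open>v i\<close> has normal \<open>w i\<close>, and putting the
  normalized \<open>w i\<close> into row \<open>i\<close> multiplies the determinant by
  \<open>norm (w i)\<close>. This gives the measures of all facets in the \<open>d\<close>-sine at
  the origin; the factorials and all but one power of the determinant cancel.\<close>

lemma d_sine_vectors_dual:
  fixes v w :: "'n \<Rightarrow> real ^ 'n"
  assumes dual: "\<And>i j. v i \<bullet> w j = of_bool (i = j)"
  shows "d_sine_vectors v = 1 / (\<bar>det (\<chi> i. v i)\<bar> * (\<Prod>i\<in>UNIV. norm (w i)))"
proof -
  define D where "D = \<bar>det (\<chi> i. v i)\<bar>"
  define N where "N = CARD('n) - 1"
  have N: "CARD('n) = Suc N"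
    by (simp add: N_def)
  have "D > 0"
    using dual_basis_expansion(2)[OF dual] by (auto simp: D_def)
  have inj: "inj v" and ind: "independent (range v)"
    using dual_basis_independent[OF dual] by auto
  have w0: "w i \<noteq> 0" and v0: "v i \<noteq> 0" for i
    using dual[of i i] by auto
  have facet: "flat_measure (convex hull (insert 0 (range v) - {v i})) = D * norm (w i) / fact N" for i
  proof -
    let ?n = "(1 / norm (w i)) *\<^sub>R w i"
    have "det (\<chi> k. if k = i then ?n else v k) = norm (w i) * det (\<chi> i. v i)"
      using det_replace_row_dual[OF dual, of i ?n] w0[of i] by (simp add: power2_norm_eq_inner[symmetric] power2_eq_square)
    moreover have "insert 0 (range v) - {v i} = insert 0 (v ` (- {i}))"
      using inj v0[of i] by (auto simp: inj_eq)
    ultimately show ?thesis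
      using flat_measure_facet[of i ?n v] \<open>D > 0\<close> w0[of i] dual
      by (simp add: D_def N_def abs_mult mult_ac inner_commute)
  qed
  have 0: "insert 0 (range v) - {0} = range v"
    using v0 by auto
  have "d_sine_vectors v = real (Suc N) ^ N * (D / fact (Suc N)) ^ N /
      (fact N * (\<Prod>i\<in>UNIV. D * norm (w i) / fact N))"
    using inj ind
    by (simp add: d_sine_vectors_def d_sine_def 0 prod.reindex facet measure_simplex D_def[symmetric] N N_def[symmetric])
  also have "real (Suc N) ^ N * (D / fact (Suc N)) ^ N = (D / fact N) ^ N"
    by (simp add: power_mult_distrib[symmetric] del: of_nat_Suc)
  also have "(\<Prod>i\<in>UNIV. D * norm (w i) / fact N) = D ^ Suc N * (\<Prod>i\<in>UNIV. norm (w i)) / fact N ^ Suc N"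
    by (simp add: prod_dividef prod.distrib N[symmetric])
  also have "(D / fact N) ^ N / (fact N * (D ^ Suc N * (\<Prod>i\<in>UNIV. norm (w i)) / fact N ^ Suc N))
      = 1 / (D * (\<Prod>i\<in>UNIV. norm (w i)))"
    using \<open>D > 0\<close> by (simp add: power_divide)
  finally show ?thesis
    by (simp add: D_def)
qed

text \<open>A crude form of Hadamard's inequality, from the Leibniz expansion; the factorial counts
  the permutations and affects only constants.\<close>

lemma abs_det_le_prod_norm:
  fixes v :: "'n \<Rightarrow> real ^ 'n"
  shows "\<bar>det (\<chi> i. v i)\<bar> \<le> fact CARD('n) * (\<Prod>i\<in>UNIV. norm (v i))"
proof -
  have "\<bar>det (\<chi> i. v i)\<bar> \<le> (\<Sum>p | p permutes (UNIV :: 'n set). \<bar>of_int (sign p) * (\<Prod>i\<in>UNIV. v i $ p i)\<bar>)"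
    unfolding det_def by (intro order_trans[OF sum_abs]) simp
  also have "\<dots> \<le> (\<Sum>p | p permutes (UNIV :: 'n set). \<Prod>i\<in>UNIV. norm (v i))"
  proof (rule sum_mono)
    fix p :: "'n \<Rightarrow> 'n"
    have "\<bar>of_int (sign p) :: real\<bar> = 1"
      by (simp add: sign_def)
    then show "\<bar>of_int (sign p) * (\<Prod>i\<in>UNIV. v i $ p i)\<bar> \<le> (\<Prod>i\<in>UNIV. norm (v i))"
      by (simp add: abs_mult abs_prod prod_mono component_le_norm_cart)
  qed
  also have "\<dots> = fact CARD('n) * (\<Prod>i\<in>UNIV. norm (v i))"
    by (simp add: card_permutations)
  finally show ?thesis .
qed

text \<open>Replacing \<open>w\<^sub>j\<close> by its component along \<open>v\<^sub>j\<close> does not change the determinant of \<open>w\<close>, which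
  replaces the factor \<open>\<parallel>w\<^sub>j\<parallel>\<close> in the trivial bound by \<open>1 / \<parallel>v\<^sub>j\<parallel>\<close>.\<close>

lemma d_sine_vectors_le:
  fixes v w :: "'n \<Rightarrow> real ^ 'n"
  assumes dual: "\<And>i j. v i \<bullet> w j = of_bool (i = j)"
  shows "d_sine_vectors v \<le> fact CARD('n) / (norm (v j) * norm (w j))"
proof -
  have w0: "norm (w i) > 0" and v0: "norm (v i) > 0" for i
    using dual[of i i] by auto
  have dual': "w i \<bullet> v j = of_bool (i = j)" for i j
    using dual[of j i] by (auto simp: inner_commute)
  \<comment> \<open>The component of \<open>w j\<close> along \<open>v j\<close>, since
    \<open>w j \<bullet> v j = 1\<close>. Its product with \<open>v j\<close> is again 1, so by
    Cramer's rule the determinant is unchanged.\<close>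
  let ?y = "(1 / (norm (v j))\<^sup>2) *\<^sub>R v j"
  let ?u = "\<lambda>k. if k = j then ?y else w k"
  have "\<bar>det (\<chi> i. w i)\<bar> = \<bar>det (\<chi> k. ?u k)\<bar>"
    using det_replace_row_dual[OF dual', of j ?y] v0[of j] by (simp add: power2_norm_eq_inner[symmetric])
  also have "\<dots> \<le> fact CARD('n) * (\<Prod>i\<in>UNIV. norm (?u i))"
    by (rule abs_det_le_prod_norm)
  also have "(\<Prod>i\<in>UNIV. norm (?u i)) = norm ?y * (\<Prod>i\<in>UNIV - {j}. norm (w i))"
    by (simp add: prod.remove[of _ j])
  also have "norm ?y = 1 / norm (v j)"
    using v0[of j] by (simp add: power2_eq_square)
  finally have *: "\<bar>det (\<chi> i. w i)\<bar> \<le> fact CARD('n) * (1 / norm (v j) * (\<Prod>i\<in>UNIV - {j}. norm (w i)))" .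
  have "det (\<chi> i. v i) * det (\<chi> i. w i) = 1"
    by (rule dual_basis_expansion(2)[OF dual])
  then have "\<bar>det (\<chi> i. w i)\<bar> = 1 / \<bar>det (\<chi> i. v i)\<bar>"
    by (metis abs_mult abs_one mult_zero_left nonzero_eq_divide_eq mult.commute zero_neq_one)
  then have "d_sine_vectors v = \<bar>det (\<chi> i. w i)\<bar> / (norm (w j) * (\<Prod>i\<in>UNIV - {j}. norm (w i)))"
    by (simp add: d_sine_vectors_dual[OF dual] prod.remove[of UNIV j])
  also have "\<dots> \<le> fact CARD('n) * (1 / norm (v j) * (\<Prod>i\<in>UNIV - {j}. norm (w i))) / (norm (w j) * (\<Prod>i\<in>UNIV - {j}. norm (w i)))"
    using * by (intro divide_right_mono) (auto intro!: mult_nonneg_nonneg prod_nonneg)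
  also have "\<dots> = fact CARD('n) / (norm (v j) * norm (w j))"
  proof -
    have "(\<Prod>i\<in>UNIV - {j}. norm (w i)) > 0"
      using w0 by (intro prod_pos) auto
    moreover have "c * (1 / a * P) / (b * P) = c / (a * b)" if "P > 0" for a b c P :: real
      using that by simp
    ultimately show ?thesis
      by blast
  qed
  finally show ?thesis .
qed

text \<open>Bounding the determinant by the norms of the \<open>v i\<close> pairs each
  \<open>norm (v i)\<close> with the \<open>norm (w i)\<close> in the denominator of the dual
  formula.\<close>

lemma d_sine_vectors_ge:
  fixes v w :: "'n \<Rightarrow> real ^ 'n"
  assumes dual: "\<And>i j. v i \<bullet> w j = of_bool (i = j)"
    and K: "\<And>i. norm (v i) * norm (w i) \<le> K"
  shows "1 / (fact CARD('n) * K ^ CARD('n)) \<le> d_sine_vectors v"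
proof -
  have w0: "norm (w i) > 0" for i
    using dual[of i i] by auto
  have pos: "(\<Prod>i\<in>UNIV. norm (w i)) > 0"
    using w0 by (intro prod_pos) auto
  have "\<bar>det (\<chi> i. v i)\<bar> > 0"
    using dual_basis_expansion(2)[OF dual] by auto
  then have "0 < \<bar>det (\<chi> i. v i)\<bar> * (\<Prod>i\<in>UNIV. norm (w i))"
    using pos by (rule mult_pos_pos)
  moreover have "\<bar>det (\<chi> i. v i)\<bar> * (\<Prod>i\<in>UNIV. norm (w i)) \<le> fact CARD('n) * K ^ CARD('n)"
  proof -
    have "\<bar>det (\<chi> i. v i)\<bar> * (\<Prod>i\<in>UNIV. norm (w i)) \<le>
        (fact CARD('n) * (\<Prod>i\<in>UNIV. norm (v i))) * (\<Prod>i\<in>UNIV. norm (w i))"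
      using pos by (intro mult_right_mono abs_det_le_prod_norm) auto
    also have "\<dots> = fact CARD('n) * (\<Prod>i\<in>UNIV. norm (v i) * norm (w i))"
      by (simp add: prod.distrib)
    also have "\<dots> \<le> fact CARD('n) * (\<Prod>i\<in>(UNIV :: 'n set). K)"
      using K by (intro mult_left_mono prod_mono) auto
    finally show ?thesis
      by simp
  qed
  ultimately show ?thesis
    unfolding d_sine_vectors_dual[OF dual] by (intro frac_le) auto
qed

section \<open>Alignment with the edges\<close>

text \<open>The cosine condition is multiplied out, so it also makes sense for \<open>x = 0\<close>,
  where it only asks for two distinct vertices.\<close>

definition edge_aligned :: "real \<Rightarrow> 'a::euclidean_space set \<Rightarrow> bool" where
  "edge_aligned \<kappa> V \<longleftrightarrow> (\<forall>x\<in>directions V. \<exists>p\<in>V. \<exists>q\<in>V. p \<noteq> q \<and>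
     \<kappa> * norm x * norm (p - q) \<le> \<bar>x \<bullet> (p - q)\<bar>)"

lemma edge_aligned_mono:
  assumes "edge_aligned \<kappa> V" "\<kappa>' \<le> \<kappa>"
  shows "edge_aligned \<kappa>' V"
  unfolding edge_aligned_def
proof
  fix x assume "x \<in> directions V"
  then obtain p q where pq: "p \<in> V" "q \<in> V" "p \<noteq> q" "\<kappa> * norm x * norm (p - q) \<le> \<bar>x \<bullet> (p - q)\<bar>"
    using assms(1) unfolding edge_aligned_def by blast
  moreover have "\<kappa>' * norm x * norm (p - q) \<le> \<kappa> * norm x * norm (p - q)"
    using assms(2) by (intro mult_right_mono) auto
  ultimately show "\<exists>p\<in>V. \<exists>q\<in>V. p \<noteq> q \<and> \<kappa>' * norm x * norm (p - q) \<le> \<bar>x \<bullet> (p - q)\<bar>"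
    by (meson order_trans)
qed

text \<open>A direction \<open>x\<close> of the facet that is badly aligned with its edges is shifted along the facet
  normal until it is orthogonal to the shortest edge \<open>a - b\<close> at the apex; then it is badly aligned
  with every other edge \<open>a - c\<close> too, because \<open>\<parallel>b - c\<parallel> \<le> 2 \<parallel>a - c\<parallel>\<close>.\<close>

lemma edge_aligned_remove:
  assumes V: "\<not> affine_dependent V" and a: "a \<in> V"
    and card: "card (V - {a}) \<ge> 2" and al: "edge_aligned \<kappa> V" and "\<kappa> > 0"
  shows "edge_aligned (\<kappa> / 2) (V - {a})"
proof (rule ccontr)
  assume "\<not> edge_aligned (\<kappa> / 2) (V - {a})"
  then obtain x where x: "x \<in> directions (V - {a})"
    and small: "\<And>p q. p \<in> V - {a} \<Longrightarrow> q \<in> V - {a} \<Longrightarrow> p \<noteq> q \<Longrightarrow>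
        \<bar>x \<bullet> (p - q)\<bar> < \<kappa> / 2 * norm x * norm (p - q)"
    unfolding edge_aligned_def by (meson not_le)
  have fin: "finite (V - {a})"
    using V aff_independent_finite by blast
  have ne: "V - {a} \<noteq> {}"
    using card by (metis card.empty not_numeral_le_zero)
  define b where "b = arg_min_on (\<lambda>c. norm (a - c)) (V - {a})"
  have b: "b \<in> V - {a}" and nearest: "\<And>c. c \<in> V - {a} \<Longrightarrow> norm (a - b) \<le> norm (a - c)"
    unfolding b_def by (rule arg_min_if_finite(1)[OF fin ne], rule arg_min_least[OF fin ne])
  note n = facet_normal[OF V a b]
  let ?n = "facet_normal V a"
  define y where "y = x - ((x \<bullet> (a - b)) / (?n \<bullet> (a - b))) *\<^sub>R ?n"
  have yz: "y \<bullet> z = x \<bullet> z" if "z \<in> directions (V - {a})" for z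
    using n(3)[OF that] by (simp add: y_def inner_diff_left)
  have yab: "y \<bullet> (a - b) = 0"
    using n(4) by (simp add: y_def inner_diff_left)
  have y: "y \<in> directions V"
    unfolding y_def using x n(1) directions_mono[of "V - {a}" V]
    by (intro subspace_diff subspace_scale subspace_directions) auto
  \<comment> \<open>\<open>x\<close> is the orthogonal projection of \<open>y\<close> to the facet
    directions, hence not longer than \<open>y\<close>.\<close>
  have "x \<bullet> x = y \<bullet> x"
    using yz[OF x] by simp
  then have "norm x * norm x \<le> norm y * norm x"
    using norm_cauchy_schwarz[of y x] by (metis norm_eq_sqrt_inner real_sqrt_mult_self abs_of_nonneg inner_ge_zero)
  moreover have "x \<noteq> 0"
  proof -
    obtain c where "c \<in> V - {a}" "c \<noteq> b"
      using card card_mono[of "{b}" "V - {a}"] by fastforce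
    then show ?thesis
      using small[OF b] by fastforce
  qed
  ultimately have nyx: "norm x \<le> norm y"
    by simp
  then have "norm y > 0"
    using \<open>x \<noteq> 0\<close> by (meson less_le_trans zero_less_norm_iff)
  obtain p q where pq: "p \<in> V" "q \<in> V" "p \<noteq> q" "\<kappa> * norm y * norm (p - q) \<le> \<bar>y \<bullet> (p - q)\<bar>"
    using al y unfolding edge_aligned_def by blast
  have apex: "\<bar>y \<bullet> (a - c)\<bar> < \<kappa> * norm y * norm (a - c)" if c: "c \<in> V - {a}" for c
  proof (cases "c = b")
    case True
    then show ?thesis
      using yab c \<open>norm y > 0\<close> \<open>\<kappa> > 0\<close> by auto
  next
    case False
    have "y \<bullet> (a - c) = y \<bullet> (a - b) + y \<bullet> (b - c)"
      by (simp add: inner_diff_right)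
    then have "\<bar>y \<bullet> (a - c)\<bar> = \<bar>x \<bullet> (b - c)\<bar>"
      using yab yz[OF diff_in_directions[OF b c]] by simp
    also have "\<dots> < \<kappa> / 2 * norm x * norm (b - c)"
      using small b c False by blast
    also have "\<dots> \<le> \<kappa> / 2 * norm y * (2 * norm (a - c))"
    proof (intro mult_mono)
      have "norm (b - c) \<le> norm (a - b) + norm (a - c)"
        using norm_triangle_ineq4[of "a - c" "a - b"] by simp
      then show "norm (b - c) \<le> 2 * norm (a - c)"
        using nearest[OF c] by simp
    qed (use nyx \<open>\<kappa> > 0\<close> in auto)
    finally show ?thesis
      by simp
  qed
  show False
  proof (cases "p = a \<or> q = a")
    case True
    then show False
    proof
      assume "p = a"
      then show False
        using apex[of q] pq by auto
    next
      assume "q = a"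
      then show False
        using apex[of p] pq by (auto simp: norm_minus_commute inner_diff_right abs_minus_commute)
    qed
  next
    case False
    then have pq': "p \<in> V - {a}" "q \<in> V - {a}"
      using pq by auto
    then have "\<bar>y \<bullet> (p - q)\<bar> < \<kappa> / 2 * norm x * norm (p - q)"
      using small[OF pq' pq(3)] yz[OF diff_in_directions[OF pq']] by simp
    also have "\<dots> \<le> \<kappa> * norm y * norm (p - q)"
      using nyx \<open>\<kappa> > 0\<close> by (intro mult_right_mono mult_mono) auto
    finally show False
      using pq(4) by simp
  qed
qed

text \<open>Vertices are removed one at a time, each at the cost of a factor 2; the bound on
  \<open>card T\<close> ensures that every intermediate face still has an edge.\<close>

lemma edge_aligned_subset:
  assumes "\<not> affine_dependent V" "edge_aligned \<kappa> V" "\<kappa> > 0" "T \<subseteq> V" "card T \<ge> 2"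
  shows "edge_aligned (\<kappa> / 2 ^ card (V - T)) T"
  using assms
proof (induction "card (V - T)" arbitrary: V \<kappa>)
  case 0
  have "finite V"
    using 0 aff_independent_finite by blast
  then have "V = T"
    using 0 by auto
  then show ?case
    using 0 by simp
next
  case (Suc m)
  have "finite V"
    using Suc.prems aff_independent_finite by blast
  obtain a where a: "a \<in> V - T"
    using Suc.hyps(2) by (metis card.empty equals0I nat.distinct(1))
  have sub: "T \<subseteq> V - {a}"
    using a Suc.prems by auto
  have "card (V - {a}) \<ge> 2"
    using card_mono[OF _ sub] \<open>finite V\<close> Suc.prems by simp
  then have "edge_aligned (\<kappa> / 2) (V - {a})"
    using Suc.prems a edge_aligned_remove by blast
  moreover have "V - T = insert a (V - {a} - T)"
    using a by auto
  then have "card (V - T) = Suc (card (V - {a} - T))"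
    using \<open>finite V\<close> by (metis DiffE Diff_insert_absorb card_insert_disjoint finite_Diff insertI1)
  moreover have "\<not> affine_dependent (V - {a})"
    using Suc.prems by (meson Diff_subset affine_independent_subset)
  ultimately show ?case
    using Suc.hyps(1)[of "V - {a}" "\<kappa> / 2"] Suc.hyps(2) Suc.prems(3,5) sub by simp
qed

text \<open>An edge avoiding \<open>a\<close> is orthogonal to the first normal, one avoiding
  \<open>b\<close> to the second, and on the edge joining \<open>a\<close> and \<open>b\<close> the
  two products have opposite signs. Hence the difference of the normals has at least the product of
  the first normal with any edge, in absolute value; alignment is applied to that normal.\<close>

lemma facet_normals_separated:
  assumes V: "\<not> affine_dependent V" and a: "a \<in> V" and b: "b \<in> V" and "a \<noteq> b"
    and al: "edge_aligned \<kappa> V"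
  shows "\<kappa> \<le> norm (facet_normal V a - facet_normal V b)"
proof -
  let ?m = "facet_normal V a" and ?n = "facet_normal V b"
  note m = facet_normal[OF V a, of b] and n = facet_normal[OF V b, of a]
  have *: "\<bar>?m \<bullet> (p - q)\<bar> \<le> \<bar>(?m - ?n) \<bullet> (p - q)\<bar>" if "p \<in> V" "q \<in> V" for p q
  proof -
    consider "p \<noteq> a \<and> q \<noteq> a" | "p \<noteq> b \<and> q \<noteq> b" | "p = a \<and> q = b" | "p = b \<and> q = a" | "p = q"
      using \<open>a \<noteq> b\<close> by blast
    then show ?thesis
    proof cases
      case 1
      then have "?m \<bullet> (p - q) = 0"
        using that b \<open>a \<noteq> b\<close> by (intro m(3) diff_in_directions) auto
      then show ?thesis by simp
    next
      case 2
      then have "?n \<bullet> (p - q) = 0"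
        using that a \<open>a \<noteq> b\<close> by (intro n(3) diff_in_directions) auto
      then show ?thesis by (simp add: inner_diff_left)
    next
      case 3
      then show ?thesis
        using m(4) n(4) a b \<open>a \<noteq> b\<close> by (auto simp: inner_diff_left inner_diff_right)
    next
      case 4
      then show ?thesis
        using m(4) n(4) a b \<open>a \<noteq> b\<close> by (auto simp: inner_diff_left inner_diff_right)
    qed simp
  qed
  have mV: "?m \<in> directions V" "norm ?m = 1"
    using m(1,2) b \<open>a \<noteq> b\<close> by auto
  then obtain p q where pq: "p \<in> V" "q \<in> V" "p \<noteq> q" "\<kappa> * norm (p - q) \<le> \<bar>?m \<bullet> (p - q)\<bar>"
    using al unfolding edge_aligned_def by (metis mult.right_neutral)
  have "\<kappa> * norm (p - q) \<le> norm (?m - ?n) * norm (p - q)"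
    using pq * [OF pq(1,2)] Cauchy_Schwarz_ineq2[of "?m - ?n" "p - q"] by linarith
  then show ?thesis
    using pq(3) by simp
qed

text \<open>For a badly aligned unit vector \<open>y\<close>, the facet component \<open>z\<close>
  has norm below \<open>\<eta> / 4\<close> by alignment of the facet, so the normal component
  differs from 1 in absolute value by less than \<open>\<eta> / 4\<close>. Together \<open>y\<close>
  or \<open>- y\<close> is within \<open>\<eta> / 2\<close> of each facet normal.\<close>

lemma edge_aligned_from_facets:
  assumes V: "\<not> affine_dependent V" and card: "card V \<ge> 3" and "\<kappa> > 0" "\<eta> > 0"
    and facets: "\<And>a. a \<in> V \<Longrightarrow> edge_aligned \<kappa> (V - {a})"
    and sep: "\<And>a b. a \<in> V \<Longrightarrow> b \<in> V \<Longrightarrow> a \<noteq> b \<Longrightarrow> \<eta> \<le> norm (facet_normal V a - facet_normal V b)"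
  shows "edge_aligned (\<kappa> * \<eta> / 4) V"
proof (rule ccontr)
  assume "\<not> edge_aligned (\<kappa> * \<eta> / 4) V"
  then obtain x where x: "x \<in> directions V"
    and small: "\<And>p q. p \<in> V \<Longrightarrow> q \<in> V \<Longrightarrow> p \<noteq> q \<Longrightarrow>
        \<bar>x \<bullet> (p - q)\<bar> < \<kappa> * \<eta> / 4 * norm x * norm (p - q)"
    unfolding edge_aligned_def by (meson not_le)
  have fin: "finite V"
    using V aff_independent_finite by blast
  obtain T where T: "T \<subseteq> V" "card T = 3"
    using card by (meson obtain_subset_with_card_n)
  then obtain a b c where abc: "a \<in> V" "b \<in> V" "c \<in> V" "a \<noteq> b" "b \<noteq> c" "a \<noteq> c"
    by (auto simp: card_3_iff)
  have "x \<noteq> 0"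
    using small[OF abc(1,2,4)] by auto
  define y where "y = (1 / norm x) *\<^sub>R x"
  have y1: "norm y = 1" and y: "y \<in> directions V"
    using x \<open>x \<noteq> 0\<close> by (auto simp: y_def subspace_scale subspace_directions)
  have ysmall: "\<bar>y \<bullet> (p - q)\<bar> < \<kappa> * \<eta> / 4 * norm (p - q)" if "p \<in> V" "q \<in> V" "p \<noteq> q" for p q
  proof -
    have "\<bar>x \<bullet> (p - q)\<bar> / norm x < \<kappa> * \<eta> / 4 * norm (p - q)"
      using small[OF that] \<open>x \<noteq> 0\<close> by (simp add: divide_less_eq mult_ac)
    moreover have "y \<bullet> (p - q) = (x \<bullet> (p - q)) / norm x"
      by (simp add: y_def)
    ultimately show ?thesis
      by (simp add: abs_divide)
  qed
  have near: "\<exists>s\<in>{1, -1}. norm (s *\<^sub>R y - facet_normal V v) < \<eta> / 2" if v: "v \<in> V" for v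
  proof -
    obtain w where w: "w \<in> V - {v}"
      using abc v by blast
    let ?n = "facet_normal V v" and ?W = "directions (V - {v})"
    note n = facet_normal[OF V v w]
    have W: "span ?W = ?W"
      by (simp add: subspace_directions)
    have dirV: "directions V = span (insert (v - w) ?W)"
      using directions_insert[OF w, of v] v by (simp add: insert_absorb)
    obtain t where t: "?n - t *\<^sub>R (v - w) \<in> ?W"
      using n(1) unfolding dirV span_insert W by blast
    obtain k where k: "y - k *\<^sub>R (v - w) \<in> ?W"
      using y unfolding dirV span_insert W by blast
    have tn: "t * (?n \<bullet> (v - w)) = 1"
      using n(3)[OF t] n(2) by (simp add: inner_diff_right norm_eq_1)
    then have "t \<noteq> 0"
      by auto
    have yk: "y \<bullet> ?n = k * (?n \<bullet> (v - w))"
      using n(3)[OF k] by (simp add: inner_diff_right inner_commute)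
    \<comment> \<open>\<open>k\<close> and \<open>t\<close> are the coefficients of \<open>y\<close>
      and of the normal along the apex edge; as \<open>(y \<bullet> ?n) * t = k\<close>, this edge
      cancels and a facet direction remains.\<close>
    have "y - (y \<bullet> ?n) *\<^sub>R ?n = (y - k *\<^sub>R (v - w)) - (y \<bullet> ?n) *\<^sub>R (?n - t *\<^sub>R (v - w))"
    proof -
      have "(y \<bullet> ?n) * t = k"
        using tn yk by (simp add: mult_ac)
      then show ?thesis
        by (simp add: scaleR_diff_right)
    qed
    define z where "z = y - (y \<bullet> ?n) *\<^sub>R ?n"
    have z: "z \<in> ?W"
      unfolding z_def \<open>y - (y \<bullet> ?n) *\<^sub>R ?n = _\<close>
      by (intro subspace_diff[OF subspace_directions] subspace_scale[OF subspace_directions] k t)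
    obtain p q where pq: "p \<in> V - {v}" "q \<in> V - {v}" "p \<noteq> q" "\<kappa> * norm z * norm (p - q) \<le> \<bar>z \<bullet> (p - q)\<bar>"
      using facets[OF v] z unfolding edge_aligned_def by blast
    have "z \<bullet> (p - q) = y \<bullet> (p - q)"
      using n(3)[OF diff_in_directions[OF pq(1,2)]] by (simp add: z_def inner_diff_left)
    then have "\<kappa> * norm z * norm (p - q) < \<kappa> * (\<eta> / 4) * norm (p - q)"
      using pq(4) ysmall[of p q] pq(1-3) by auto
    then have nz: "norm z < \<eta> / 4"
      using \<open>\<kappa> > 0\<close> pq(3) by simp
    have c1: "\<bar>y \<bullet> ?n\<bar> \<le> 1"
      using Cauchy_Schwarz_ineq2[of y ?n] y1 n(2) by simp
    have "norm y \<le> norm ((y \<bullet> ?n) *\<^sub>R ?n) + norm z"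
      using norm_triangle_ineq[of "(y \<bullet> ?n) *\<^sub>R ?n" z] by (simp add: z_def)
    then have c2: "1 - \<bar>y \<bullet> ?n\<bar> < \<eta> / 4"
      using y1 n(2) nz by simp
    define s :: real where "s = (if y \<bullet> ?n \<ge> 0 then 1 else -1)"
    have s: "s \<in> {1, -1}" "s * (y \<bullet> ?n) = \<bar>y \<bullet> ?n\<bar>" "\<bar>s\<bar> = 1"
      by (auto simp: s_def)
    have "s *\<^sub>R y - ?n = s *\<^sub>R z + (s * (y \<bullet> ?n) - 1) *\<^sub>R ?n"
      by (simp add: z_def algebra_simps)
    then have "norm (s *\<^sub>R y - ?n) \<le> norm z + \<bar>\<bar>y \<bullet> ?n\<bar> - 1\<bar>"
      using norm_triangle_ineq[of "s *\<^sub>R z" "(s * (y \<bullet> ?n) - 1) *\<^sub>R ?n"] s n(2) by simp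
    also have "\<dots> < \<eta> / 2"
      using nz c1 c2 by simp
    finally show ?thesis
      using s(1) by blast
  qed
  define P where "P v s \<longleftrightarrow> norm (s *\<^sub>R y - facet_normal V v) < \<eta> / 2" for v s
  have conflict: False if "u \<in> V" "v \<in> V" "u \<noteq> v" "P u s" "P v s" for u v and s :: real
  proof -
    have "norm (facet_normal V u - facet_normal V v) \<le>
        norm (s *\<^sub>R y - facet_normal V v) + norm (s *\<^sub>R y - facet_normal V u)"
      using norm_triangle_ineq4[of "s *\<^sub>R y - facet_normal V v" "s *\<^sub>R y - facet_normal V u"] by simp
    then show False
      using that sep[OF that(1-3)] by (simp add: P_def)
  qed
  \<comment> \<open>Three vertices share two signs, so two of the normals are close to the same
    vector, hence closer to each other than \<open>\<eta>\<close>.\<close>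
  have "P v 1 \<or> P v (-1)" if "v \<in> V" for v
    using near[OF that] by (auto simp: P_def)
  then show False
    using conflict abc by metis
qed

section \<open>Dihedral angles and distances of facet normals\<close>

lemma convex_hull_remove_eq_iff:
  fixes V :: "'a::euclidean_space set"
  assumes V: "\<not> affine_dependent V" and "a \<in> V" "b \<in> V"
  shows "convex hull (V - {a}) = convex hull (V - {b}) \<longleftrightarrow> a = b"
proof
  assume eq: "convex hull (V - {a}) = convex hull (V - {b})"
  show "a = b"
  proof (rule ccontr)
    assume "a \<noteq> b"
    then have "b \<in> convex hull (V - {a})"
      using assms by (intro hull_inc) auto
    then have "b \<in> affine hull (V - {b})"
      using eq convex_hull_subset_affine_hull by blast
    then show False
      using V \<open>b \<in> V\<close> by (auto simp: affine_dependent_def)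
  qed
qed simp

text \<open>Facets correspond bijectively to opposite vertices. Two vertices make the set of angles
  nonempty, so that its \<open>Max\<close> is meaningful.\<close>

lemma max_dihedral_angle_le_iff:
  fixes V :: "'a::euclidean_space set"
  assumes V: "\<not> affine_dependent V" and card: "card V \<ge> 2"
  shows "max_dihedral_angle (convex hull V) \<le> \<gamma> \<longleftrightarrow>
    (\<forall>a\<in>V. \<forall>b\<in>V. a \<noteq> b \<longrightarrow> arccos (- (facet_normal V a \<bullet> facet_normal V b)) \<le> \<gamma>)"
proof -
  have fin: "finite V"
    using V aff_independent_finite by blast
  obtain T where "T \<subseteq> V" "card T = 2"
    using card by (meson obtain_subset_with_card_n)
  then obtain p q where pq: "p \<in> V" "q \<in> V" "p \<noteq> q"
    by (auto simp: card_2_iff)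
  let ?ang = "\<lambda>(a, b). arccos (- (facet_normal V a \<bullet> facet_normal V b))"
  have facet: "F facet_of convex hull V \<longleftrightarrow> (\<exists>u\<in>V. F = convex hull (V - {u}))" for F
    using facet_of_convex_hull_affine_independent_alt[OF V] card by auto
  have angle: "dihedral_angle (convex hull V) (convex hull (V - {a})) (convex hull (V - {b})) = ?ang (a, b)" for a b
    by (simp add: dihedral_angle_def facet_normal_def)
  have "{dihedral_angle (convex hull V) F G | F G. F facet_of convex hull V \<and> G facet_of convex hull V \<and> F \<noteq> G}
      = ?ang ` {(a, b) \<in> V \<times> V. a \<noteq> b}" (is "?A = ?B")
  proof (intro equalityI subsetI)
    fix t assume "t \<in> ?A"
    then obtain a b where "a \<in> V" "b \<in> V" "a \<noteq> b" "t = ?ang (a, b)"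
      unfolding facet using angle by blast
    then show "t \<in> ?B"
      by blast
  next
    fix t assume "t \<in> ?B"
    then obtain a b where ab: "a \<in> V" "b \<in> V" "a \<noteq> b" "t = ?ang (a, b)"
      by blast
    have "t = dihedral_angle (convex hull V) (convex hull (V - {a})) (convex hull (V - {b}))"
      unfolding angle by (rule ab(4))
    moreover have "convex hull (V - {a}) \<noteq> convex hull (V - {b})"
      using convex_hull_remove_eq_iff[OF V ab(1,2)] ab(3) by blast
    ultimately show "t \<in> ?A"
      unfolding facet using ab(1,2) by blast
  qed
  moreover have "finite ?B"
    using fin finite_subset[of "{(a, b) \<in> V \<times> V. a \<noteq> b}" "V \<times> V"] by auto
  moreover have "?B \<noteq> {}"
    using pq by blast
  ultimately show ?thesis
    unfolding max_dihedral_angle_def by (subst Max_le_iff) auto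
qed

lemma norm_diff_unit:
  fixes n m :: "'a::real_inner"
  assumes "norm n = 1" "norm m = 1"
  shows "(norm (n - m))\<^sup>2 = 2 - 2 * (n \<bullet> m)"
  using assms by (simp add: power2_norm_eq_inner inner_diff_left inner_diff_right inner_commute norm_eq_1)

text \<open>If \<beta> is the dihedral angle, the squared distance of the normals is
  \<open>2 + 2 * cos \<beta>\<close>, and the cosine decreases on the interval from 0 to
  \<open>pi\<close>.\<close>

lemma norm_diff_ge_of_angle:
  fixes n m :: "'a::real_inner"
  assumes "norm n = 1" "norm m = 1" "arccos (- (n \<bullet> m)) \<le> \<gamma>" "0 \<le> \<gamma>" "\<gamma> < pi"
  shows "sqrt (2 + 2 * cos \<gamma>) \<le> norm (n - m)"
proof -
  have *: "\<bar>n \<bullet> m\<bar> \<le> 1"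
    using Cauchy_Schwarz_ineq2[of n m] assms by simp
  then have "cos \<gamma> \<le> cos (arccos (- (n \<bullet> m)))"
    using assms arccos_lbound[of "- (n \<bullet> m)"] by (intro cos_monotone_0_pi_le) auto
  also have "\<dots> = - (n \<bullet> m)"
    using * by (intro cos_arccos_abs) simp
  finally have "2 + 2 * cos \<gamma> \<le> (norm (n - m))\<^sup>2"
    using norm_diff_unit[OF assms(1,2)] by simp
  then show ?thesis
    by (intro real_le_lsqrt) auto
qed

text \<open>The same identity read backwards: distance at least \<delta> means that the cosine of
  the dihedral angle is at least \<open>\<delta>\<^sup>2 / 2 - 1\<close>.\<close>

lemma angle_le_of_norm_diff:
  fixes n m :: "'a::real_inner"
  assumes "norm n = 1" "norm m = 1" "\<delta> \<le> norm (n - m)" "0 \<le> \<delta>"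
  shows "arccos (- (n \<bullet> m)) \<le> arccos (\<delta>\<^sup>2 / 2 - 1)"
proof -
  have "\<bar>n \<bullet> m\<bar> \<le> 1"
    using Cauchy_Schwarz_ineq2[of n m] assms by simp
  moreover have "\<delta>\<^sup>2 \<le> 2 - 2 * (n \<bullet> m)"
    using power_mono[OF assms(3,4), of 2] norm_diff_unit[OF assms(1,2)] by simp
  ultimately show ?thesis
    by (intro arccos_le_arccos) auto
qed

text \<open>Base of the induction on dimension: all directions of a line are multiples of its one
  edge vector.\<close>

lemma edge_aligned_pair:
  assumes "card V = 2"
  shows "edge_aligned 1 V"
  unfolding edge_aligned_def
proof
  fix x assume x: "x \<in> directions V"
  obtain p q where V: "V = {p, q}" and "p \<noteq> q"
    using assms by (auto simp: card_2_iff)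
  have "directions {q} = {0}"
    by (simp add: directions_def)
  then have "directions V = span {p - q}"
    using directions_insert[of q "{q}" p] V by (simp add: insert_commute)
  then obtain k where "x = k *\<^sub>R (p - q)"
    using x by (auto simp: span_singleton)
  then have "1 * norm x * norm (p - q) \<le> \<bar>x \<bullet> (p - q)\<bar>"
    by (simp add: abs_mult power2_norm_eq_inner[symmetric] power2_eq_square)
  then show "\<exists>p\<in>V. \<exists>q\<in>V. p \<noteq> q \<and> 1 * norm x * norm (p - q) \<le> \<bar>x \<bullet> (p - q)\<bar>"
    using V \<open>p \<noteq> q\<close> by blast
qed

text \<open>Iterates \<open>edge_aligned_from_facets\<close> from edges upwards, each dimension
  costing a factor \<open>\<eta> / 4\<close>. Separation is assumed for all faces with at least
  three vertices because the induction descends to facets of facets.\<close>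

lemma edge_aligned_of_separated_normals:
  fixes V :: "'a::euclidean_space set"
  assumes "\<not> affine_dependent V" "card V = m + 2" "\<eta> > 0"
    and "\<And>T a b. T \<subseteq> V \<Longrightarrow> card T \<ge> 3 \<Longrightarrow> a \<in> T \<Longrightarrow> b \<in> T \<Longrightarrow> a \<noteq> b \<Longrightarrow>
      \<eta> \<le> norm (facet_normal T a - facet_normal T b)"
  shows "edge_aligned ((\<eta> / 4) ^ m) V"
  using assms
proof (induction m arbitrary: V)
  case 0
  then show ?case
    by (simp add: edge_aligned_pair)
next
  case (Suc m)
  have "edge_aligned ((\<eta> / 4) ^ m * \<eta> / 4) V"
  proof (rule edge_aligned_from_facets)
    fix a assume "a \<in> V"
    show "edge_aligned ((\<eta> / 4) ^ m) (V - {a})"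
    proof (rule Suc.IH)
      show "\<not> affine_dependent (V - {a})"
        using Suc.prems(1) by (meson Diff_subset affine_independent_subset)
      show "card (V - {a}) = m + 2"
        using \<open>a \<in> V\<close> Suc.prems(2) by simp
      show "\<eta> \<le> norm (facet_normal T b - facet_normal T c)"
        if "T \<subseteq> V - {a}" "card T \<ge> 3" "b \<in> T" "c \<in> T" "b \<noteq> c" for T b c
        using that by (intro Suc.prems(4)) auto
    qed (rule Suc.prems(3))
  next
    show "\<eta> \<le> norm (facet_normal V a - facet_normal V b)" if "a \<in> V" "b \<in> V" "a \<noteq> b" for a b
      using that Suc.prems(2) by (intro Suc.prems(4)) auto
  qed (use Suc.prems in auto)
  then show ?case
    by (simp add: mult_ac)
qed

section \<open>Well-conditioned bases of edges\<close>

lemma ex_dual_basis_det: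
  fixes v :: "'n \<Rightarrow> real ^ 'n"
  assumes "det (\<chi> i. v i) \<noteq> 0"
  shows "\<exists>w. \<forall>i j. v i \<bullet> w j = of_bool (i = j)"
proof -
  obtain B where B: "(\<chi> i. v i) ** B = mat 1"
    using assms invertible_det_nz invertible_def by metis
  have "v i \<bullet> column j B = ((\<chi> i. v i) ** B) $ i $ j" for i j
    by (simp add: matrix_matrix_mult_def column_def inner_vec_def)
  then show ?thesis
    by (intro exI[of _ "\<lambda>j. column j B"]) (simp add: B mat_def)
qed

text \<open>The edges issuing from one vertex form a basis; this makes the maximum of the normalized
  determinant in the next lemma positive.\<close>

lemma ex_edge_basis:
  fixes V :: "(real ^ 'n) set"
  assumes V: "\<not> affine_dependent V" and card: "card V = CARD('n) + 1"
  shows "\<exists>p q. (\<forall>i. p i \<in> V \<and> q i \<in> V \<and> p i \<noteq> q i) \<and> det (\<chi> i. q i - p i) \<noteq> 0"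
proof -
  have fin: "finite V"
    using V aff_independent_finite by blast
  obtain a where a: "a \<in> V"
    using card by fastforce
  have "card (V - {a}) = CARD('n)"
    using a card by simp
  then obtain f where f: "bij_betw f (UNIV :: 'n set) (V - {a})"
    using fin finite_same_card_bij[of "UNIV :: 'n set" "V - {a}"] by auto
  have "independent ((\<lambda>x. - a + x) ` (V - {a}))"
    using V affine_dependent_iff_dependent2[OF a] by blast
  moreover have "(\<lambda>x. - a + x) ` (V - {a}) = range (\<lambda>i. f i - a)"
  proof -
    have "V - {a} = range f"
      using f by (simp add: bij_betw_def)
    then show ?thesis
      by (simp add: image_image)
  qed
  moreover have "inj (\<lambda>i. f i - a)"
    using f by (auto simp: bij_betw_def inj_on_def)
  ultimately obtain w where "\<And>i j. (f i - a) \<bullet> w j = of_bool (i = j)"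
    using ex_dual_basis[of "\<lambda>i. f i - a"] by auto
  then have "det (\<chi> i. f i - a) \<noteq> 0"
    using dual_basis_expansion(2)[of "\<lambda>i. f i - a" w] by auto
  moreover have "f i \<in> V \<and> f i \<noteq> a" for i
    using f by (auto simp: bij_betw_def)
  ultimately show ?thesis
    using a by (intro exI[of _ "\<lambda>i. a"] exI[of _ f]) auto
qed

lemma edge_aligned_imp_edge_basis:
  fixes V :: "(real ^ 'n) set"
  assumes V: "\<not> affine_dependent V" and card: "card V = CARD('n) + 1"
    and al: "edge_aligned \<kappa> V" and "\<kappa> > 0"
  shows "\<exists>p q w :: 'n \<Rightarrow> real ^ 'n. (\<forall>i. p i \<in> V \<and> q i \<in> V \<and> p i \<noteq> q i) \<and>
    (\<forall>i j. (q i - p i) \<bullet> w j = of_bool (i = j)) \<and> (\<forall>i. norm (q i - p i) * norm (w i) \<le> 1 / \<kappa>)"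
proof -
  define E where "E = {(p, q) \<in> V \<times> V. p \<noteq> q}"
  define u where "u e = snd e - fst e" for e :: "(real ^ 'n) \<times> (real ^ 'n)"
  \<comment> \<open>Dividing by the lengths makes \<open>g\<close> depend only on the directions of
    the chosen edges.\<close>
  define g where "g f = \<bar>det (\<chi> i. u (f i))\<bar> / (\<Prod>i\<in>UNIV. norm (u (f i)))" for f :: "'n \<Rightarrow> (real ^ 'n) \<times> (real ^ 'n)"
  define M where "M = (UNIV :: 'n set) \<rightarrow>\<^sub>E E"
  have "finite V"
    using V aff_independent_finite by blast
  then have "finite E"
    using finite_subset[of E "V \<times> V"] by (auto simp: E_def)
  then have finM: "finite M"
    unfolding M_def by (intro finite_PiE) auto
  have u0: "norm (u e) > 0" if "e \<in> E" for e
    using that by (auto simp: E_def u_def)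
  obtain p0 q0 where pq0: "\<And>i. p0 i \<in> V \<and> q0 i \<in> V \<and> p0 i \<noteq> q0 i" "det (\<chi> i. q0 i - p0 i) \<noteq> 0"
    using ex_edge_basis[OF V card] by metis
  define f0 where "f0 i = (p0 i, q0 i)" for i
  have f0E: "f0 i \<in> E" for i
    using pq0(1)[of i] by (simp add: E_def f0_def)
  then have f0: "f0 \<in> M"
    by (simp add: M_def PiE_iff)
  have "det (\<chi> i. u (f0 i)) \<noteq> 0"
    using pq0(2) by (simp add: f0_def u_def)
  then have "g f0 > 0"
    unfolding g_def using u0[OF f0E] by (intro divide_pos_pos prod_pos) auto
  define f where "f = arg_min_on (\<lambda>h. - g h) M"
  have f: "f \<in> M"
    unfolding f_def using finM f0 by (intro arg_min_if_finite(1)) auto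
  have f_max: "g h \<le> g f" if "h \<in> M" for h
    using arg_min_least[OF finM _ that, of "\<lambda>h. - g h"] f0 unfolding f_def by fastforce
  have fE: "f i \<in> E" for i
    using f by (auto simp: M_def)
  have "g f > 0"
    using \<open>g f0 > 0\<close> f_max[OF f0] by linarith
  then have det: "det (\<chi> i. u (f i)) \<noteq> 0"
    by (auto simp: g_def)
  obtain w where w: "\<And>i j. u (f i) \<bullet> w j = of_bool (i = j)"
    using ex_dual_basis_det[OF det] by blast
  \<comment> \<open>Exchanging the \<open>j\<close>-th chosen edge for \<open>e\<close> multiplies
    the determinant by \<open>u e \<bullet> w j\<close>; after cancelling the common factor,
    maximality of \<open>g f\<close> is exactly this bound.\<close>
  have max: "\<bar>u e \<bullet> w j\<bar> * norm (u (f j)) \<le> norm (u e)" if e: "e \<in> E" for e j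
  proof -
    define P where "P = (\<Prod>i\<in>UNIV - {j}. norm (u (f i)))"
    have P: "P > 0"
      unfolding P_def by (intro prod_pos) (use u0 fE in blast)
    have "f(j := e) \<in> M"
      using f e by (auto simp: M_def PiE_iff extensional_def)
    then have "g (f(j := e)) \<le> g f"
      by (rule f_max)
    moreover have "(\<Prod>i\<in>UNIV. norm (u ((f(j := e)) i))) = norm (u e) * P"
      unfolding P_def by (simp add: prod.remove[of UNIV j])
    moreover have "(\<Prod>i\<in>UNIV. norm (u (f i))) = norm (u (f j)) * P"
      unfolding P_def by (simp add: prod.remove[of UNIV j])
    moreover have "(\<chi> i. u ((f(j := e)) i)) = (\<chi> k. if k = j then u e else u (f k))"
      by (simp add: vec_eq_iff)
    ultimately have "\<bar>u e \<bullet> w j\<bar> * \<bar>det (\<chi> i. u (f i))\<bar> / (norm (u e) * P)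
        \<le> \<bar>det (\<chi> i. u (f i))\<bar> / (norm (u (f j)) * P)"
      using det_replace_row_dual[OF w, of j "u e"] by (simp add: g_def abs_mult)
    then have "(\<bar>u e \<bullet> w j\<bar> / norm (u e)) * (\<bar>det (\<chi> i. u (f i))\<bar> / P)
        \<le> (1 / norm (u (f j))) * (\<bar>det (\<chi> i. u (f i))\<bar> / P)"
      by simp
    moreover have "\<bar>det (\<chi> i. u (f i))\<bar> / P > 0"
      using det P by simp
    ultimately have "\<bar>u e \<bullet> w j\<bar> / norm (u e) \<le> 1 / norm (u (f j))"
      by (simp only: mult_le_cancel_right_pos)
    then show ?thesis
      using u0[OF e] u0[OF fE[of j]] by (simp add: field_simps)
  qed
  \<comment> \<open>The chosen edges span, so \<open>w j\<close> is a direction of \<open>V\<close>.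
    Alignment yields an edge with a large product with \<open>w j\<close>, while \<open>max\<close>
    bounds this product from above.\<close>
  have K: "norm (u (f j)) * norm (w j) \<le> 1 / \<kappa>" for j
  proof -
    have "u (f k) \<in> directions V" for k
      using fE[of k] by (auto simp: E_def u_def intro: diff_in_directions)
    then have "(\<Sum>k\<in>UNIV. (w j \<bullet> w k) *\<^sub>R u (f k)) \<in> directions V"
      by (intro subspace_sum subspace_scale subspace_directions)
    then have "w j \<in> directions V"
      using dual_basis_expansion(1)[OF w] by simp
    then obtain p q where pq: "p \<in> V" "q \<in> V" "p \<noteq> q" "\<kappa> * norm (w j) * norm (p - q) \<le> \<bar>w j \<bullet> (p - q)\<bar>"
      using al unfolding edge_aligned_def by blast
    have "\<bar>w j \<bullet> (p - q)\<bar> * norm (u (f j)) \<le> norm (p - q)"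
      using max[of "(q, p)" j] pq by (simp add: E_def u_def inner_commute)
    moreover have "\<kappa> * norm (w j) * norm (p - q) * norm (u (f j)) \<le> \<bar>w j \<bullet> (p - q)\<bar> * norm (u (f j))"
      using pq(4) by (intro mult_right_mono) auto
    ultimately have "(\<kappa> * norm (w j) * norm (u (f j))) * norm (p - q) \<le> 1 * norm (p - q)"
      by (simp add: mult_ac)
    then have "\<kappa> * norm (w j) * norm (u (f j)) \<le> 1"
      using pq(3) by (subst (asm) mult_le_cancel_right_pos) auto
    then show ?thesis
      using \<open>\<kappa> > 0\<close> by (simp add: field_simps)
  qed
  have "fst (f i) \<in> V \<and> snd (f i) \<in> V \<and> fst (f i) \<noteq> snd (f i)" for i
    using fE[of i] by (auto simp: E_def)
  note basis = this w[unfolded u_def] K[unfolded u_def]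
  show ?thesis
    by (rule exI[of _ "\<lambda>i. fst (f i)"], rule exI[of _ "\<lambda>i. snd (f i)"], rule exI[of _ w])
      (use basis in blast)
qed

text \<open>Expand \<open>x\<close> in the dual basis with coefficients
  \<open>x \<bullet> v k\<close>. If all were below the bound, each of the \<open>d\<close> summands
  would have norm less than \<open>norm x / d\<close>, as \<open>norm (v k) * norm (w k)\<close> is
  at most \<open>fact d / C\<close>; this dictates the constant.\<close>

lemma d_sine_imp_edge_aligned:
  fixes p q :: "'n \<Rightarrow> real ^ 'n"
  assumes pq: "\<And>i. p i \<in> V" "\<And>i. q i \<in> V"
    and C: "C \<le> d_sine_vectors (\<lambda>i. q i - p i)" "C > 0"
  shows "edge_aligned (C / (CARD('n) * fact CARD('n))) V"
  unfolding edge_aligned_def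
proof
  let ?\<kappa> = "C / (CARD('n) * fact CARD('n))"
  fix x assume "x \<in> directions V"
  define v where "v i = q i - p i" for i
  \<comment> \<open>A positive value excludes the default 0 that \<open>d_sine_vectors\<close> takes
    on dependent vectors.\<close>
  have "inj v \<and> independent (range v)"
    using C unfolding v_def[symmetric] d_sine_vectors_def by (auto split: if_splits)
  then obtain w where w: "\<And>i j. v i \<bullet> w j = of_bool (i = j)"
    using ex_dual_basis by blast
  then have w': "w i \<bullet> v j = of_bool (i = j)" for i j
    using w[of j i] by (auto simp: inner_commute)
  have pos: "norm (v i) > 0" "norm (w i) > 0" for i
    using w[of i i] by auto
  have bound: "norm (v k) * norm (w k) \<le> fact CARD('n) / C" for k
  proof -
    have "C \<le> fact CARD('n) / (norm (v k) * norm (w k))"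
      using C(1) d_sine_vectors_le[OF w, of k] unfolding v_def[symmetric] by linarith
    then show ?thesis
      using pos[of k] \<open>C > 0\<close> by (simp add: field_simps)
  qed
  have "\<exists>k. ?\<kappa> * norm x * norm (v k) \<le> \<bar>x \<bullet> v k\<bar>"
  proof (rule ccontr)
    assume "\<not> ?thesis"
    then have small: "\<bar>x \<bullet> v k\<bar> < ?\<kappa> * norm x * norm (v k)" for k
      by (simp add: not_le)
    have "norm x = norm (\<Sum>k\<in>UNIV. (x \<bullet> v k) *\<^sub>R w k)"
      using dual_basis_expansion(1)[OF w'] by simp
    also have "\<dots> \<le> (\<Sum>k\<in>UNIV. \<bar>x \<bullet> v k\<bar> * norm (w k))"
      by (rule order_trans[OF norm_sum]) simp
    also have "\<dots> < (\<Sum>k\<in>(UNIV :: 'n set). norm x / CARD('n))"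
    proof (rule sum_strict_mono)
      fix k :: 'n
      have "\<bar>x \<bullet> v k\<bar> * norm (w k) < ?\<kappa> * norm x * norm (v k) * norm (w k)"
        using small pos(2) by (intro mult_strict_right_mono)
      also have "\<dots> = ?\<kappa> * norm x * (norm (v k) * norm (w k))"
        by simp
      also have "\<dots> \<le> ?\<kappa> * norm x * (fact CARD('n) / C)"
        using bound[of k] \<open>C > 0\<close> by (intro mult_left_mono) auto
      also have "\<dots> = norm x / CARD('n)"
        using \<open>C > 0\<close> by simp
      finally show "\<bar>x \<bullet> v k\<bar> * norm (w k) < norm x / CARD('n)" .
    qed auto
    finally show False
      by simp
  qed
  then obtain k where k: "?\<kappa> * norm x * norm (v k) \<le> \<bar>x \<bullet> v k\<bar>"
    by blast
  show "\<exists>p\<in>V. \<exists>q\<in>V. p \<noteq> q \<and> ?\<kappa> * norm x * norm (p - q) \<le> \<bar>x \<bullet> (p - q)\<bar>"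
    using pq[of k] k pos(1)[of k] unfolding v_def by (intro bexI[of _ "q k"] bexI[of _ "p k"]) auto
qed

section \<open>Subsimplices and edges by their vertices, and the equivalence\<close>

lemma subsimplex_convex_hull_iff:
  assumes V: "\<not> affine_dependent V"
  shows "subsimplex k S' (convex hull V) \<longleftrightarrow> (\<exists>T\<subseteq>V. int (card T) = k + 1 \<and> S' = convex hull T)"
proof
  assume sub: "subsimplex k S' (convex hull V)"
  then obtain T where T: "\<not> affine_dependent T" "int (card T) = k + 1" "S' = convex hull T"
    by (auto simp: subsimplex_def simplex_def)
  then have "T \<subseteq> V"
    using sub extreme_point_of_convex_hull_affine_independent[OF V]
      extreme_point_of_convex_hull_affine_independent[OF T(1)] by (auto simp: subsimplex_def)
  then show "\<exists>T\<subseteq>V. int (card T) = k + 1 \<and> S' = convex hull T"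
    using T by blast
next
  assume "\<exists>T\<subseteq>V. int (card T) = k + 1 \<and> S' = convex hull T"
  then obtain T where T: "T \<subseteq> V" "int (card T) = k + 1" "S' = convex hull T"
    by blast
  then have "\<not> affine_dependent T"
    using V affine_independent_subset by blast
  then show "subsimplex k S' (convex hull V)"
    using T extreme_point_of_convex_hull_affine_independent[OF V] hull_mono[OF T(1)]
      extreme_point_of_convex_hull_affine_independent[of T]
    by (auto simp: subsimplex_def intro: simplex_convex_hull)
qed

lemma closed_segment_edge_of_convex_hull_iff:
  fixes V :: "'a::euclidean_space set"
  assumes V: "\<not> affine_dependent V"
  shows "closed_segment a b edge_of convex hull V \<longleftrightarrow> a \<in> V \<and> b \<in> V \<and> a \<noteq> b"
proof
  assume e: "closed_segment a b edge_of convex hull V"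
  then have "a extreme_point_of convex hull V" "b extreme_point_of convex hull V"
    using extreme_point_of_face[of "closed_segment a b" "convex hull V"] extreme_point_of_segment
    by (auto simp: edge_of_def)
  moreover have "a \<noteq> b"
    using e by (auto simp: edge_of_def)
  ultimately show "a \<in> V \<and> b \<in> V \<and> a \<noteq> b"
    using extreme_point_of_convex_hull_affine_independent[OF V] by blast
next
  assume ab: "a \<in> V \<and> b \<in> V \<and> a \<noteq> b"
  then have "closed_segment a b face_of convex hull V"
    unfolding face_of_convex_hull_affine_independent[OF V] segment_convex_hull
    by (intro exI[of _ "{a, b}"]) auto
  then show "closed_segment a b edge_of convex hull V"
    using ab by (simp add: edge_of_def segment_convex_hull aff_dim_convex_hull aff_dim_2)
qed

theorem theorem3p7:
  fixes \<Omega> :: "(real ^ 'n) set" and \<F> :: "(real ^ 'n) set set set"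
  assumes "CARD('n) \<ge> 2"
    and "polytopic \<Omega>"
    and "partition_family (closure \<Omega>) \<F>"
  shows "maximum_angle_condition \<F> \<longleftrightarrow> generalized_maximum_angle_condition \<F>"
proof
  let ?d = "CARD('n)"
  have simplex: "\<exists>V. \<not> affine_dependent V \<and> card V = ?d + 1 \<and> S = convex hull V"
    if "\<T> \<in> \<F>" "S \<in> \<T>" for \<T> S
  proof -
    have "int ?d simplex S"
      using assms(3) that by (auto simp: partition_family_def face_to_face_partition_def)
    then show ?thesis
      unfolding simplex_def by (metis of_nat_1 of_nat_add of_nat_eq_iff)
  qed
  {
    assume "maximum_angle_condition \<F>"
    then obtain \<gamma>\<^sub>0 where \<gamma>\<^sub>0: "\<gamma>\<^sub>0 < pi" and angles: "\<And>\<T> S k S'. \<T> \<in> \<F> \<Longrightarrow> S \<in> \<T> \<Longrightarrow> k \<ge> 2 \<Longrightarrow>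
        subsimplex k S' S \<Longrightarrow> max_dihedral_angle S' \<le> \<gamma>\<^sub>0"
      unfolding maximum_angle_condition_def by metis
    define \<gamma> where "\<gamma> = max 0 \<gamma>\<^sub>0"
    have \<gamma>: "0 \<le> \<gamma>" "\<gamma> < pi" "\<gamma>\<^sub>0 \<le> \<gamma>"
      using \<gamma>\<^sub>0 by (auto simp: \<gamma>_def)
    define \<eta> where "\<eta> = sqrt (2 + 2 * cos \<gamma>)"
    have "cos pi < cos \<gamma>"
      using \<gamma> by (intro cos_monotone_0_pi) auto
    then have "\<eta> > 0"
      by (simp add: \<eta>_def)
    \<comment> \<open>The exponent matches the \<open>d + 1 = (d - 1) + 2\<close> vertices of the
      simplex in \<open>edge_aligned_of_separated_normals\<close>.\<close>
    define \<kappa> where "\<kappa> = (\<eta> / 4) ^ (?d - 1)"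
    have "\<kappa> > 0"
      using \<open>\<eta> > 0\<close> by (simp add: \<kappa>_def)
    define C where "C = 1 / (fact ?d * (1 / \<kappa>) ^ ?d)"
    have "C > 0"
      using \<open>\<kappa> > 0\<close> by (simp add: C_def)
    have "\<exists>a b :: 'n \<Rightarrow> real ^ 'n. inj (\<lambda>i. closed_segment (a i) (b i)) \<and>
        (\<forall>i. closed_segment (a i) (b i) edge_of S) \<and> d_sine_vectors (\<lambda>i. b i - a i) \<ge> C"
      if TS: "\<T> \<in> \<F>" "S \<in> \<T>" for \<T> S
    proof -
      obtain V where V: "\<not> affine_dependent V" "card V = ?d + 1" "S = convex hull V"
        using simplex[OF TS] by blast
      have "edge_aligned \<kappa> V"
        unfolding \<kappa>_def
      proof (rule edge_aligned_of_separated_normals[OF V(1) _ \<open>\<eta> > 0\<close>])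
        show "card V = ?d - 1 + 2"
          using V(2) assms(1) by simp
        fix T a b assume T: "T \<subseteq> V" "card T \<ge> 3" and ab: "a \<in> T" "b \<in> T" "a \<noteq> b"
        have indT: "\<not> affine_dependent T"
          using V(1) T(1) affine_independent_subset by blast
        have "subsimplex (int (card T) - 1) (convex hull T) S"
          unfolding V(3) subsimplex_convex_hull_iff[OF V(1)] using T(1) by auto
        then have "max_dihedral_angle (convex hull T) \<le> \<gamma>\<^sub>0"
          using angles[OF TS, of "int (card T) - 1"] T(2) by simp
        then have "arccos (- (facet_normal T a \<bullet> facet_normal T b)) \<le> \<gamma>"
          using max_dihedral_angle_le_iff[OF indT, of \<gamma>\<^sub>0] T(2) ab \<gamma>(3) by (auto intro: order_trans)
        then show "\<eta> \<le> norm (facet_normal T a - facet_normal T b)"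
          unfolding \<eta>_def using facet_normal(2)[OF indT, of a b] facet_normal(2)[OF indT, of b a] ab \<gamma>
          by (intro norm_diff_ge_of_angle) auto
      qed
      then obtain p q w :: "'n \<Rightarrow> real ^ 'n" where pq: "\<And>i. p i \<in> V \<and> q i \<in> V \<and> p i \<noteq> q i"
        and w: "\<And>i j. (q i - p i) \<bullet> w j = of_bool (i = j)"
        and K: "\<And>i. norm (q i - p i) * norm (w i) \<le> 1 / \<kappa>"
        using edge_aligned_imp_edge_basis[OF V(1,2) _ \<open>\<kappa> > 0\<close>] by metis
      \<comment> \<open>Equal segments have edge vectors equal up to sign, which duality with
        \<open>w\<close> allows only for equal indices.\<close>
      have "inj (\<lambda>i. closed_segment (p i) (q i))"
      proof
        fix i j assume "closed_segment (p i) (q i) = closed_segment (p j) (q j)"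
        then have "q i - p i = q j - p j \<or> q i - p i = - (q j - p j)"
          by (auto simp: closed_segment_eq doubleton_eq_iff)
        then have "(q i - p i) \<bullet> w i = (q j - p j) \<bullet> w i \<or> (q i - p i) \<bullet> w i = - ((q j - p j) \<bullet> w i)"
          by (metis inner_minus_left)
        then have "(q j - p j) \<bullet> w i \<noteq> 0"
          using w[of i i] by (simp only: refl of_bool_eq) linarith
        then show "i = j"
          using w[of j i] by (auto split: if_splits)
      qed
      moreover have "closed_segment (p i) (q i) edge_of S" for i
        unfolding V(3) closed_segment_edge_of_convex_hull_iff[OF V(1)] by (rule pq)
      moreover have "d_sine_vectors (\<lambda>i. q i - p i) \<ge> C"
        unfolding C_def by (rule d_sine_vectors_ge[OF w K])
      ultimately show ?thesis
        by blast
    qed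
    then show "generalized_maximum_angle_condition \<F>"
      unfolding generalized_maximum_angle_condition_def using \<open>C > 0\<close> by blast
  next
    assume "generalized_maximum_angle_condition \<F>"
    then obtain C where "C > 0" and edges: "\<forall>\<T>\<in>\<F>. \<forall>S\<in>\<T>. \<exists>a b :: 'n \<Rightarrow> real ^ 'n.
        inj (\<lambda>i. closed_segment (a i) (b i)) \<and>
        (\<forall>i. closed_segment (a i) (b i) edge_of S) \<and> d_sine_vectors (\<lambda>i. b i - a i) \<ge> C"
      unfolding generalized_maximum_angle_condition_def by (elim exE conjE)
    define \<kappa> where "\<kappa> = C / (?d * fact ?d)"
    \<comment> \<open>At most \<open>d + 1\<close> vertices are removed to reach a subsimplex, each
      halving the constant. The cap 1 keeps \<open>\<delta>\<^sup>2 / 2 - 1\<close> below 1, and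
      positivity keeps it above -1, so its \<open>arccos\<close> is less than
      \<open>pi\<close>.\<close>
    define \<delta> where "\<delta> = min 1 (\<kappa> / 2 ^ (?d + 1))"
    have "\<kappa> > 0"
      using \<open>C > 0\<close> by (simp add: \<kappa>_def)
    then have \<delta>: "0 < \<delta>" "\<delta> \<le> 1"
      by (simp_all add: \<delta>_def)
    have "arccos (\<delta>\<^sup>2 / 2 - 1) < pi"
      using \<delta> power_le_one[of \<delta> 2] arccos_lt_bounded[of "\<delta>\<^sup>2 / 2 - 1"] by simp
    moreover have "max_dihedral_angle S' \<le> arccos (\<delta>\<^sup>2 / 2 - 1)"
      if TS: "\<T> \<in> \<F>" "S \<in> \<T>" and "k \<ge> 2" and sub: "subsimplex k S' S" for \<T> S k S'
    proof -
      obtain V where V: "\<not> affine_dependent V" "card V = ?d + 1" "S = convex hull V"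
        using simplex[OF TS] by blast
      obtain T where T: "T \<subseteq> V" "int (card T) = k + 1" "S' = convex hull T"
        using sub unfolding V(3) subsimplex_convex_hull_iff[OF V(1)] by blast
      then have card: "card T \<ge> 2" and indT: "\<not> affine_dependent T"
        using \<open>k \<ge> 2\<close> V(1) affine_independent_subset by auto
      obtain a b :: "'n \<Rightarrow> real ^ 'n" where "\<And>i. closed_segment (a i) (b i) edge_of S"
        and C: "C \<le> d_sine_vectors (\<lambda>i. b i - a i)"
        using edges[rule_format, OF TS] by (elim exE conjE) blast
      then have "a i \<in> V" "b i \<in> V" for i
        unfolding V(3) closed_segment_edge_of_convex_hull_iff[OF V(1)] by auto
      then have "edge_aligned \<kappa> V"
        unfolding \<kappa>_def using C \<open>C > 0\<close> by (rule d_sine_imp_edge_aligned)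
      then have "edge_aligned (\<kappa> / 2 ^ card (V - T)) T"
        using V(1) \<open>\<kappa> > 0\<close> T(1) card by (intro edge_aligned_subset)
      moreover have "\<delta> \<le> \<kappa> / 2 ^ card (V - T)"
      proof -
        have "finite V"
          using V(1) aff_independent_finite by blast
        then have "card (V - T) \<le> ?d + 1"
          using card_mono[of V "V - T"] V(2) by auto
        then have "(2 :: real) ^ card (V - T) \<le> 2 ^ (?d + 1)"
          by (intro power_increasing) auto
        then have "\<kappa> / 2 ^ (?d + 1) \<le> \<kappa> / 2 ^ card (V - T)"
          using \<open>\<kappa> > 0\<close> by (intro divide_left_mono) auto
        then show ?thesis
          by (simp add: \<delta>_def)
      qed
      ultimately have al: "edge_aligned \<delta> T"
        by (rule edge_aligned_mono)
      show ?thesis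
        unfolding T(3) max_dihedral_angle_le_iff[OF indT card]
      proof (intro ballI impI)
        fix x y assume xy: "x \<in> T" "y \<in> T" "x \<noteq> y"
        show "arccos (- (facet_normal T x \<bullet> facet_normal T y)) \<le> arccos (\<delta>\<^sup>2 / 2 - 1)"
          using facet_normals_separated[OF indT xy al] \<delta>(1)
            facet_normal(2)[OF indT, of x y] facet_normal(2)[OF indT, of y x] xy
          by (intro angle_le_of_norm_diff) auto
      qed
    qed
    ultimately show "maximum_angle_condition \<F>"
      unfolding maximum_angle_condition_def by blast
  }
qed

end
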